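(* Let $b>1$ be an integer and $w$ a non-empty word over $\{0,\dots,b-1\}$, with associated point $x_w\in[0,1]$, probability measures $(\nu_n)_{n\ge1}$ and monic polynomials $(\mathcal B_m)_{m\ge0}$. Let $f$ be analytic at $x_w$, and suppose that the radius of convergence $r$ of its Taylor series at $x_w$ satisfies $r>R_w=\max(x_w,1-x_w)$, i.e. $[0,1]\subset D(x_w,r)$. Then (denoting again by $f$ the sum of the Taylor series on the open disk $D(x_w,r)$) $$\forall x\in D(x_w,r)\qquad f(x)=\sum_{m=0}^\infty\Bigl(\int_0^1f^{(m)}(t)\,d\nu_{m+1}(t)\Bigr)\frac{\mathcal B_m(x)}{m!},$$ with uniform geometric convergence on the compact subsets of $D(x_w,r)$ (i.e. for each compact $K\subset D(x_w,r)$ there are $C<\infty$ and $\rho<1$ such that the $m$-th term is bounded by $C\rho^m$ on $K$ for all $m$).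
   Context: Words are finite sequences (possibly empty) of digits in $\{0,\dots,b-1\}$; $|g|$ is the length of $g$; $n(g)$ is the integer represented by $g$ in base $b$ (most significant digit on the left); $x(g)=n(g)b^{-|g|}$; for an infinite digit sequence, $x(d_1d_2\dots)=\sum_id_ib^{-i}$. $k_w(g)$ is the number of occurrences (with overlaps) of $w$ in $g$ as a block of consecutive digits, and $k_w^+(g)=k_w(wg)-1$. $\mathcal G$ is the set of non-empty words $g$ with $k_w^+(g)=1$ and $k_w^+(g^-)=0$, where $g^-$ is $g$ with its last digit deleted. $\lambda_s(w)=\sum_{g\in\mathcal G}b^{-s|g|}$ for $s\ge1$; $\lambda_1(w)=1$ and the $\lambda_n(w)$, $n\geq1$ integer, are distinct. $\nu_n$ is the law on $[0,1]$ of $x(G_1G_2\cdots)$ (infinite concatenation), with $G_i$ i.i.d. in $\mathcal G$, $\mathbb P(G_i=g)=b^{-n|g|}/\lambda_n(w)$. On functions, $(\mathsf K_wf)(x)=\sum_{g\in\mathcal G}b^{-|g|}f(x(g)+b^{-|g|}x)$; $\mathcal B_m$ is the unique monic polynomial of degree $m$ with $\mathsf K_w\mathcal B_m=\lambda_{m+1}(w)\mathcal B_m$. A border of $w$ is a non-empty word, different from $w$, that is both a prefix and a suffix of $w$. The word $g_w$ is $w$ if $w$ has no border; otherwise, if $v$ is the longest border and $w=vs$, then $g_w=s$ ($g_w$ is the unique shortest word of $\mathcal G$). Finally $x_w=x(g_wg_wg_w\cdots)$. *)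

theory Defs
  imports
    "HOL-Probability.Probability"
    "HOL-Complex_Analysis.Complex_Analysis"
    "HOL-Library.Sublist"
begin

text \<open>
  Words over the digits \<open>0, \<dots>, b - 1\<close> are lists in \<^term>\<open>lists {..<b}\<close>, most significant digit first.
\<close>

definition word_int :: "nat \<Rightarrow> nat list \<Rightarrow> nat" where
  "word_int b g = horner_sum id b (rev g)"

definition word_pt :: "nat \<Rightarrow> nat list \<Rightarrow> real" where
  "word_pt b g = real (word_int b g) / real b ^ length g"

definition stream_pt :: "nat \<Rightarrow> nat stream \<Rightarrow> real" where
  "stream_pt b d = (\<Sum>i. real (d !! i) / real b ^ Suc i)"

definition occ :: "nat list \<Rightarrow> nat list \<Rightarrow> nat" where
  "occ w g = card {i. i + length w \<le> length g \<and> take (length w) (drop i g) = w}"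

text \<open>The subtraction does not truncate, since \<open>w\<close> occurs in \<open>w @ g\<close>.\<close>

definition occ_plus :: "nat list \<Rightarrow> nat list \<Rightarrow> nat" where
  "occ_plus w g = occ w (w @ g) - 1"

definition gap_words :: "nat \<Rightarrow> nat list \<Rightarrow> nat list set" where
  "gap_words b w =
     {g \<in> lists {..<b}. g \<noteq> [] \<and> occ_plus w g = 1 \<and> occ_plus w (butlast g) = 0}"

definition lam :: "nat \<Rightarrow> nat list \<Rightarrow> real \<Rightarrow> real" where
  "lam b w s = (\<Sum>\<^sub>\<infinity>g\<in>gap_words b w. real b powr (- s * real (length g)))"

definition gap_law :: "nat \<Rightarrow> nat list \<Rightarrow> nat \<Rightarrow> nat list measure" where
  "gap_law b w n =
     point_measure (gap_words b w)
       (\<lambda>g. ennreal (real b powr (- real n * real (length g)) / lam b w (real n)))"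

text \<open>
  \<^const>\<open>stream_space\<close> is the law of an i.i.d. sequence, and \<^const>\<open>flat\<close> concatenates a
  sequence of (here non-empty) words. The law on \<open>[0,1]\<close> is regarded as a Borel measure on \<open>\<real>\<close>.
\<close>

definition nu :: "nat \<Rightarrow> nat list \<Rightarrow> nat \<Rightarrow> real measure" where
  "nu b w n = distr (stream_space (gap_law b w n)) borel (\<lambda>G. stream_pt b (flat G))"

definition K_op :: "nat \<Rightarrow> nat list \<Rightarrow> (complex \<Rightarrow> complex) \<Rightarrow> complex \<Rightarrow> complex" where
  "K_op b w f x =
     (\<Sum>\<^sub>\<infinity>g\<in>gap_words b w.
        f (of_real (word_pt b g) + x / of_nat b ^ length g) / of_nat b ^ length g)"

text \<open>
  The coefficients of these polynomials are real; they are taken in \<^typ>\<open>complex poly\<close> because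
  they are evaluated on complex disks.
\<close>

definition B_poly :: "nat \<Rightarrow> nat list \<Rightarrow> nat \<Rightarrow> complex poly" where
  "B_poly b w m =
     (THE p. degree p = m \<and> lead_coeff p = 1 \<and>
        (\<forall>x. K_op b w (poly p) x = of_real (lam b w (real (m + 1))) * poly p x))"

definition border :: "nat list \<Rightarrow> nat list \<Rightarrow> bool" where
  "border w v \<longleftrightarrow> v \<noteq> [] \<and> v \<noteq> w \<and> prefix v w \<and> suffix v w"

text \<open>Dropping the first \<open>length v\<close> letters of \<open>w = v @ s\<close> leaves \<open>s\<close>.\<close>

definition min_gap :: "nat list \<Rightarrow> nat list" where
  "min_gap w =
     (if \<exists>v. border w v then drop (Max (length ` {v. border w v})) w else w)"

definition center :: "nat \<Rightarrow> nat list \<Rightarrow> real" where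
  "center b w = stream_pt b (cycle (min_gap w))"

definition taylor_sum :: "(complex \<Rightarrow> complex) \<Rightarrow> complex \<Rightarrow> complex \<Rightarrow> complex" where
  "taylor_sum f z x = eval_fps (fps_expansion f z) (x - z)"

text \<open>
  The term of index \<open>m\<close> of the expansion; the derivatives are those of the sum of the Taylor
  series, since \<open>f\<close> itself is only given near \<^term>\<open>center b w\<close>.
\<close>

definition exp_term :: "nat \<Rightarrow> nat list \<Rightarrow> (complex \<Rightarrow> complex) \<Rightarrow> nat \<Rightarrow> complex \<Rightarrow> complex" where
  "exp_term b w f m x =
     (LINT t:{0..1}|nu b w (m + 1).
        (deriv ^^ m) (taylor_sum f (of_real (center b w))) (of_real t))
     * (poly (B_poly b w m) x / fact m)"

end

theory Submission
  imports Defs "HOL-Real_Asymp.Real_Asymp"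
begin

text \<open>
  Let \<open>s\<close> be the shortest gap word and \<open>\<phi> g x = x(g) + b\<^sup>-\<^sup>|\<^sup>g\<^sup>| x\<close>, so that \<open>\<phi> s\<close> fixes \<open>xw\<close>. The law
  \<open>\<nu>\<close> of index \<open>n\<close> is the stationary mixture of its images under the \<open>\<phi> g\<close>, with weights
  proportional to \<open>b\<^sup>-\<^sup>n\<^sup>|\<^sup>g\<^sup>|\<close>. Hence the functionals \<open>\<ell> m f = (1/m!) \<integral> f\<^sup>(\<^sup>m\<^sup>) d\<nu>\<close> (index \<open>m + 1\<close>) are
  left eigenvectors of \<open>K\<close>, and the triangular matrix \<open>c n m = \<ell> m ((x - xw)\<^sup>n)\<close> expresses
  \<open>(x - xw)\<^sup>n\<close> in terms of the eigenpolynomials. Every gap word ends with \<open>s\<close>, say \<open>g = h s\<close>; therefore,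
  for \<open>\<rho> > R = max xw (1 - xw)\<close>, the gain of \<open>1 - |t - xw| / \<rho>\<close> under \<open>\<phi> g\<close> compensates the weight
  \<open>b\<^sup>-\<^sup>n\<^sup>|\<^sup>h\<^sup>|\<close> and self-similarity bounds \<open>\<integral> (1 - |t - xw| / \<rho>)\<^sup>-\<^sup>n d\<nu>\<close> uniformly in \<open>n\<close>. With Cauchy's
  inequality this gives \<open>\<ell> m f = O(\<rho>\<^sup>-\<^sup>m)\<close> whenever \<open>f\<close> is holomorphic near the closed disk of radius
  \<open>\<rho>\<close>. Moreover \<open>\<integral> |t - xw| d\<nu> = O(b\<^sup>-\<^sup>n)\<close>, so the off-diagonal row sums of \<open>c\<close>, weighted by powers of
  \<open>\<rho>\<close>, tend to \<open>0\<close>, and the polynomials are \<open>O(\<rho>\<^sup>m)\<close> on the disk of radius \<open>\<rho>\<close>, for every \<open>\<rho> > R\<close>.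
\<close>

subsection \<open>Words, points and occurrences\<close>

lemma word_int_Nil [simp]: "word_int b [] = 0"
  by (simp add: word_int_def)

lemma word_int_append: "word_int b (g @ h) = word_int b g * b ^ length h + word_int b h"
  by (simp add: word_int_def horner_sum_append)

lemma word_int_Cons: "word_int b (x # g) = x * b ^ length g + word_int b g"
  by (simp add: word_int_def horner_sum_append)

lemma word_int_less:
  assumes "g \<in> lists {..<b}" and "b > 0"
  shows "word_int b g < b ^ length g"
  using assms(1)
proof (induction g)
  case (Cons x g)
  have "word_int b (x # g) < x * b ^ length g + b ^ length g"
    using Cons by (simp add: word_int_Cons)
  also have "\<dots> = Suc x * b ^ length g" by simp
  also have "\<dots> \<le> b * b ^ length g" using Cons by (intro mult_right_mono) auto
  finally show ?case by simp
qed auto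

lemma word_pt_Nil [simp]: "word_pt b [] = 0"
  by (simp add: word_pt_def)

lemma word_pt_append:
  assumes "b > 0"
  shows "word_pt b (g @ h) = word_pt b g + word_pt b h / real b ^ length g"
  using assms by (simp add: word_pt_def word_int_append power_add field_simps)

lemma word_pt_nonneg: "word_pt b g \<ge> 0"
  by (simp add: word_pt_def)

lemma word_pt_le:
  assumes "g \<in> lists {..<b}" and "b > 0"
  shows "word_pt b g \<le> 1 - 1 / real b ^ length g"
proof -
  have "real (word_int b g) \<le> real b ^ length g - 1"
  proof -
    have "Suc (word_int b g) \<le> b ^ length g" using word_int_less[OF assms] by simp
    hence "real (Suc (word_int b g)) \<le> real (b ^ length g)" by (rule of_nat_mono)
    thus ?thesis by simp
  qed
  thus ?thesis using assms(2) by (simp add: word_pt_def field_simps)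
qed

lemma stream_pt_summable:
  assumes "d \<in> streams {..<b}" and "b > 1"
  shows "summable (\<lambda>i. real (d !! i) / real b ^ Suc i)"
proof (rule summable_comparison_test')
  show "summable (\<lambda>i. (1 / real b) ^ i)"
    using assms(2) by (intro summable_geometric) auto
  fix i :: nat
  have "d !! i < b" using assms(1) by (simp add: streams_iff_snth)
  thus "norm (real (d !! i) / real b ^ Suc i) \<le> (1 / real b) ^ i"
    using assms(2) by (simp add: field_simps)
qed

lemma stream_pt_Stream:
  assumes "x ## d \<in> streams {..<b}" and "b > 1"
  shows "stream_pt b (x ## d) = (real x + stream_pt b d) / real b"
proof -
  have "stream_pt b (x ## d) = (\<Sum>i. real (d !! i) / real b ^ Suc (Suc i)) + real x / real b"
    using suminf_split_head[OF stream_pt_summable[OF assms]] unfolding stream_pt_def by simp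
  also have "(\<Sum>i. real (d !! i) / real b ^ Suc (Suc i)) = stream_pt b d / real b"
    unfolding stream_pt_def using assms stream_pt_summable[of d b]
    by (subst suminf_divide[symmetric]) (auto simp: streams_Stream field_simps)
  finally show ?thesis using assms by (simp add: field_simps)
qed

lemma stream_pt_shift:
  assumes "g \<in> lists {..<b}" and "d \<in> streams {..<b}" and "b > 1"
  shows "stream_pt b (g @- d) = word_pt b g + stream_pt b d / real b ^ length g"
  using assms(1)
proof (induction g)
  case (Cons x g)
  have "stream_pt b ((x # g) @- d) = (real x + stream_pt b (g @- d)) / real b"
    using Cons assms stream_pt_Stream[of x "g @- d" b] by (auto intro!: shift_streams)
  also have "\<dots> = word_pt b (x # g) + stream_pt b d / real b ^ length (x # g)"
    using Cons assms(3) by (simp add: word_pt_def word_int_Cons field_simps)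
  finally show ?case .
qed simp

lemma stream_pt_bounds:
  assumes "d \<in> streams {..<b}" and "b > 1"
  shows "0 \<le> stream_pt b d" and "stream_pt b d \<le> 1"
proof -
  show "0 \<le> stream_pt b d" unfolding stream_pt_def
    by (intro suminf_nonneg stream_pt_summable assms) auto
  have g: "(\<lambda>i. (1 / real b) ^ i) sums (1 / (1 - 1 / real b))"
    using assms(2) by (intro geometric_sums) auto
  have "stream_pt b d \<le> (\<Sum>i. (real b - 1) / real b * (1 / real b) ^ i)"
    unfolding stream_pt_def
  proof (intro suminf_le stream_pt_summable assms)
    fix i :: nat
    have "d !! i < b" using assms(1) by (simp add: streams_iff_snth)
    hence "real (d !! i) \<le> real b - 1" by linarith
    thus "real (d !! i) / real b ^ Suc i \<le> (real b - 1) / real b * (1 / real b) ^ i"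
      using assms(2) by (simp add: field_simps)
  qed (use g in \<open>auto simp: sums_iff intro: summable_mult\<close>)
  also have "\<dots> = (real b - 1) / real b * (1 / (1 - 1 / real b))"
    using g by (subst suminf_mult) (auto simp: sums_iff)
  also have "\<dots> = 1" using assms(2) by (simp add: field_simps)
  finally show "stream_pt b d \<le> 1" .
qed

section \<open>Positions of occurrences and the prefix-free set of gap words\<close>

definition occurs_at :: "nat list \<Rightarrow> nat list \<Rightarrow> nat \<Rightarrow> bool" where
  "occurs_at w g i \<longleftrightarrow> i + length w \<le> length g \<and> take (length w) (drop i g) = w"

lemma occ_alt: "occ w g = card {i. occurs_at w g i}"
  by (simp add: occ_def occurs_at_def)

lemma finite_occurs_at [simp]: "finite {i. occurs_at w g i}"
  by (rule finite_subset[of _ "{..length g}"]) (auto simp: occurs_at_def)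

lemma occurs_at_append: "occurs_at w g i \<Longrightarrow> occurs_at w (g @ h) i"
  by (auto simp: occurs_at_def)

lemma occurs_at_prefix: "occurs_at w (g @ h) i \<Longrightarrow> i + length w \<le> length g \<Longrightarrow> occurs_at w g i"
  by (auto simp: occurs_at_def)

lemma occurs_at_0 [simp]: "occurs_at w (w @ g) 0"
  by (auto simp: occurs_at_def)

text \<open>Position \<open>0\<close> is always an occurrence, so the count minus one vanishes
  exactly when there is no other. Working with the set of positions avoids the subtraction from here
  on.\<close>

lemma occ_plus_zero_iff:
  "occ_plus w g = 0 \<longleftrightarrow> {i. occurs_at w (w @ g) i} = {0}"
proof
  assume "occ_plus w g = 0"
  moreover have "card {i. occurs_at w (w @ g) i} \<noteq> 0"
    by (subst card_0_eq) (auto intro: occurs_at_0)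
  ultimately have "card {i. occurs_at w (w @ g) i} = 1"
    unfolding occ_plus_def occ_alt by linarith
  then obtain x where x: "{i. occurs_at w (w @ g) i} = {x}" by (auto simp: card_1_singleton_iff)
  moreover have "0 \<in> {i. occurs_at w (w @ g) i}" by simp
  ultimately show "{i. occurs_at w (w @ g) i} = {0}" by auto
qed (simp add: occ_plus_def occ_alt)

lemma occ_plus_zero_prefix:
  assumes "occ_plus w (g @ h) = 0"
  shows "occ_plus w g = 0"
proof -
  have "{i. occurs_at w (w @ g @ h) i} = {0}" using assms by (simp add: occ_plus_zero_iff)
  moreover have "{i. occurs_at w (w @ g) i} \<subseteq> {i. occurs_at w (w @ g @ h) i}"
    using occurs_at_append[of w "w @ g" _ h] by auto
  ultimately show ?thesis by (auto simp: occ_plus_zero_iff)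
qed

text \<open>Deleting the last digit of \<open>g\<close> destroys only the occurrence that ends
  there, namely the one at position \<open>length g\<close>. So the single new occurrence that
  \<open>g\<close> creates has to be that one.\<close>

lemma gap_words_iff:
  "g \<in> gap_words b w \<longleftrightarrow>
     g \<in> lists {..<b} \<and> g \<noteq> [] \<and> {i. occurs_at w (w @ g) i} = {0, length g}"
proof (cases "g = []")
  case False
  have g: "w @ g = (w @ butlast g) @ [last g]" using False by simp
  have butlast_occ: "{i. occurs_at w (w @ butlast g) i} = {i. occurs_at w (w @ g) i} - {length g}"
  proof (intro set_eqI iffI)
    fix i assume "i \<in> {i. occurs_at w (w @ butlast g) i}"
    then have i: "occurs_at w (w @ butlast g) i" by simp
    hence "i \<le> length g - 1" by (simp add: occurs_at_def)
    moreover have "length g > 0" using False by simp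
    ultimately have "i < length g" by linarith
    with i show "i \<in> {i. occurs_at w (w @ g) i} - {length g}"
      using occurs_at_append[OF i, of "[last g]"] g by simp
  next
    fix i assume i: "i \<in> {i. occurs_at w (w @ g) i} - {length g}"
    hence "i < length g" by (auto simp: occurs_at_def)
    thus "i \<in> {i. occurs_at w (w @ butlast g) i}"
      using i g by (auto intro!: occurs_at_prefix[of w "w @ butlast g" "[last g]"])
  qed
  have "occ_plus w g = 1 \<and> occ_plus w (butlast g) = 0 \<longleftrightarrow>
          {i. occurs_at w (w @ g) i} = {0, length g}" (is "?L \<longleftrightarrow> ?S = _")
  proof
    assume L: ?L
    hence d: "?S - {length g} = {0}" by (simp add: occ_plus_zero_iff butlast_occ)
    have "length g \<in> ?S"
    proof (rule ccontr)
      assume "length g \<notin> ?S"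
      hence "?S = {0}" using d by blast
      hence "occ_plus w g = 0" by (simp add: occ_plus_zero_iff)
      thus False using L by simp
    qed
    thus "?S = {0, length g}" using d by blast
  next
    assume S: "?S = {0, length g}"
    hence "occ_plus w g = 1" using False by (simp add: occ_plus_def occ_alt)
    moreover have "occ_plus w (butlast g) = 0"
      unfolding occ_plus_zero_iff butlast_occ S using False by auto
    ultimately show ?L by simp
  qed
  thus ?thesis using False by (auto simp: gap_words_def)
qed (simp add: gap_words_def)

text \<open>A proper prefix of \<open>h\<close> is a prefix of \<open>butlast h\<close>, and up to
  there no new occurrence of \<open>w\<close> has been completed.\<close>

lemma gap_words_prefix_free:
  assumes "g \<in> gap_words b w" "h \<in> gap_words b w" "prefix g h"
  shows "g = h"
proof (rule ccontr)
  assume "g \<noteq> h"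
  hence "strict_prefix g h" using assms(3) by auto
  then obtain u where "butlast h = g @ u"
    by (metis butlast_append strict_prefixE' list.distinct(1))
  hence "occ_plus w g = 0" using assms(2) occ_plus_zero_prefix[of w g u] by (simp add: gap_words_def)
  thus False using assms(1) by (simp add: gap_words_def)
qed

text \<open>Kraft's inequality, by counting: the words of a fixed length \<open>L\<close> that
  extend different members of \<open>F\<close> are different, and there are \<open>b ^ L\<close>
  words of length \<open>L\<close> in all.\<close>

lemma kraft:
  assumes fin: "finite F" and sub: "F \<subseteq> lists {..<b}" and b: "b > 0"
    and free: "\<And>g h. g \<in> F \<Longrightarrow> h \<in> F \<Longrightarrow> prefix g h \<Longrightarrow> g = h"
  shows "(\<Sum>g\<in>F. (1 / real b) ^ length g) \<le> 1"
proof -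
  define L where "L = Max (insert 0 (length ` F))"
  have L: "length g \<le> L" if "g \<in> F" for g unfolding L_def using that fin by (intro Max_ge) auto
  define W where "W n = {u. set u \<subseteq> {..<b} \<and> length u = n}" for n
  have cW: "card (W n) = b ^ n" and fW: "finite (W n)" for n
    unfolding W_def by (auto simp: card_lists_length_eq finite_lists_length_eq)
  \<comment> \<open>\<open>E g\<close> consists of the words of length \<open>L\<close> that begin
    with \<open>g\<close>, since no member of \<open>F\<close> is longer than
    \<open>L\<close>.\<close>
  define E where "E g = (\<lambda>u. g @ u) ` W (L - length g)" for g
  have cE: "card (E g) = b ^ (L - length g)" for g
    unfolding E_def by (subst card_image) (auto simp: cW inj_on_def)
  have "(\<Sum>g\<in>F. card (E g)) = card (\<Union>g\<in>F. E g)"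
  proof (rule card_UN_disjoint[symmetric])
    show "\<forall>g\<in>F. \<forall>h\<in>F. g \<noteq> h \<longrightarrow> E g \<inter> E h = {}"
    proof (intro ballI impI, rule ccontr)
      fix g h assume gh: "g \<in> F" "h \<in> F" "g \<noteq> h" "E g \<inter> E h \<noteq> {}"
      then obtain u where "prefix g u" "prefix h u" unfolding E_def by (auto simp: prefix_def)
      hence "prefix g h \<or> prefix h g" using prefix_same_cases by blast
      thus False using free gh by metis
    qed
  qed (auto simp: fin E_def fW)
  also have "\<dots> \<le> card (W L)"
  proof (intro card_mono fW)
    show "(\<Union>g\<in>F. E g) \<subseteq> W L" using sub L unfolding E_def W_def by fastforce
  qed
  finally have "(\<Sum>g\<in>F. b ^ (L - length g)) \<le> b ^ L" by (simp add: cE cW)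
  hence "(\<Sum>g\<in>F. real b ^ (L - length g)) \<le> real b ^ L"
    using of_nat_mono[where ?'a=real] by fastforce
  also have "(\<Sum>g\<in>F. real b ^ (L - length g)) = (\<Sum>g\<in>F. (1 / real b) ^ length g) * real b ^ L"
    unfolding sum_distrib_right using b by (intro sum.cong) (auto simp: power_diff L power_divide)
  finally show ?thesis using b by simp
qed

text \<open>Kraft's inequality bounds all finite partial sums by 1. This is the majorant behind the
  later sums over gap words.\<close>

lemma gap_words_summable:
  assumes "b > 0"
  shows "(\<lambda>g. (1 / real b) ^ length g) summable_on gap_words b w"
proof (rule nonneg_bdd_above_summable_on)
  show "bdd_above (sum (\<lambda>g. (1 / real b) ^ length g) ` {F. F \<subseteq> gap_words b w \<and> finite F})"
  proof (rule bdd_aboveI2)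
    fix F assume "F \<in> {F. F \<subseteq> gap_words b w \<and> finite F}"
    thus "(\<Sum>g\<in>F. (1 / real b) ^ length g) \<le> 1"
      by (intro kraft assms gap_words_prefix_free) (auto simp: gap_words_def)
  qed
qed auto

text \<open>The longest border, or the empty word: in both cases \<open>w\<close> continues it by \<open>min_gap w\<close>.\<close>

lemma min_gap_split:
  assumes "w \<noteq> []"
  obtains v where "w = v @ min_gap w" "min_gap w \<noteq> []" "prefix v w" "suffix v w"
    "\<And>u. prefix u w \<Longrightarrow> suffix u w \<Longrightarrow> u \<noteq> w \<Longrightarrow> length u \<le> length v"
proof (cases "\<exists>v. border w v")
  case True
  have fin: "finite {v. border w v}"
    by (rule finite_subset[of _ "set (prefixes w)"]) (auto simp: border_def)
  have "Max (length ` {v. border w v}) \<in> length ` {v. border w v}"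
    using fin True by (intro Max_in) auto
  then obtain v where v: "border w v" "length v = Max (length ` {v. border w v})" by auto
  have s: "min_gap w = drop (length v) w" using True v by (simp add: min_gap_def)
  have w: "w = v @ min_gap w" using v(1) s by (auto simp: border_def prefix_def)
  show ?thesis
  proof (rule that[OF w])
    show "min_gap w \<noteq> []" using w v(1) by (auto simp: border_def)
    fix u assume u: "prefix u w" "suffix u w" "u \<noteq> w"
    show "length u \<le> length v"
    proof (cases "u = []")
      case False
      thus ?thesis unfolding v(2) using u by (intro Max_ge finite_imageI fin imageI) (auto simp: border_def)
    qed simp
  qed (use v in \<open>auto simp: border_def\<close>)
next
  case False
  show ?thesis
  proof (rule that[of "[]"])
    fix u assume "prefix u w" "suffix u w" "u \<noteq> w"
    thus "length u \<le> length []" using False by (auto simp: border_def)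
  qed (use False assms in \<open>auto simp: min_gap_def\<close>)
qed

section \<open>Overlaps, borders and the shortest gap word\<close>

lemma occurs_at_overlap:
  assumes "occurs_at w (w @ g) i" and "i \<le> length w"
  shows "prefix (drop i w) w" and "suffix (drop i w) w"
proof -
  have "drop i w @ take (length w - (length w - i)) (drop (i - length w) g) = w"
    using assms by (auto simp: occurs_at_def)
  thus "prefix (drop i w) w" by (metis prefixI)
qed (rule suffix_drop)

lemma occurs_at_end: "occurs_at w (w @ g) (length g) \<longleftrightarrow> suffix w (w @ g)"
proof -
  have "length (drop (length g) (w @ g)) = length w" by simp
  hence "take (length w) (drop (length g) (w @ g)) = drop (length g) (w @ g)" by simp
  moreover have "suffix w (w @ g) \<longleftrightarrow> w = drop (length g) (w @ g)"
  proof
    assume "suffix w (w @ g)"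
    then obtain u where u: "w @ g = u @ w" by (auto simp: suffix_def)
    moreover have "length u = length g" using arg_cong[OF u, of length] by simp
    ultimately show "w = drop (length g) (w @ g)" by simp
  qed (metis suffix_drop)
  ultimately show ?thesis by (auto simp: occurs_at_def)
qed

text \<open>Two occurrences of \<open>w\<close> at distance \<open>i\<close> less than
  \<open>length (min_gap w)\<close> overlap in \<open>drop i w\<close>, which is both a prefix and a
  suffix of \<open>w\<close> and would be longer than the longest border.\<close>

lemma length_min_gap_le_occurrence:
  assumes "w \<noteq> []" and "occurs_at w (w @ g) i" and "i > 0"
  shows "length (min_gap w) \<le> i"
proof (rule ccontr)
  assume less: "\<not> length (min_gap w) \<le> i"
  obtain v where v: "w = v @ min_gap w"
    "\<And>u. prefix u w \<Longrightarrow> suffix u w \<Longrightarrow> u \<noteq> w \<Longrightarrow> length u \<le> length v"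
    using min_gap_split[OF assms(1)] by blast
  have lw: "length w = length v + length (min_gap w)" by (metis v(1) length_append)
  have "length (drop i w) \<le> length v"
  proof (rule v(2))
    show "drop i w \<noteq> w" using assms less lw by (metis diff_less length_drop length_greater_0_conv less_irrefl)
  qed (use assms less lw in \<open>auto intro!: occurs_at_overlap\<close>)
  thus False using less lw by simp
qed

text \<open>Let \<open>v\<close> be the longest border, or empty, and \<open>w = u v = v s\<close>.
  Then \<open>w s = u v s = u w\<close>, so \<open>w\<close> recurs at the end; by the preceding
  lemma it cannot recur earlier.\<close>

lemma min_gap_in_gap_words:
  assumes "w \<noteq> []" and "w \<in> lists {..<b}"
  shows "min_gap w \<in> gap_words b w"
proof -
  obtain v where v: "w = v @ min_gap w" "min_gap w \<noteq> []" "suffix v w"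
    using min_gap_split[OF assms(1)] by blast
  obtain u where u: "w = u @ v" using v(3) by (auto simp: suffix_def)
  have "w @ min_gap w = u @ w" using u v(1) by (metis append_assoc)
  hence "occurs_at w (w @ min_gap w) (length (min_gap w))"
    unfolding occurs_at_end by (simp add: suffix_def)
  moreover have "i = 0 \<or> i = length (min_gap w)" if "occurs_at w (w @ min_gap w) i" for i
  proof (cases "i = 0")
    case False
    have "i \<le> length (min_gap w)" using that by (simp add: occurs_at_def)
    thus ?thesis using length_min_gap_le_occurrence[OF assms(1) that] False by simp
  qed simp
  ultimately have "{i. occurs_at w (w @ min_gap w) i} = {0, length (min_gap w)}"
    by auto
  moreover have "min_gap w \<in> lists {..<b}" using assms(2) v(1) by (metis append_in_lists_conv)
  ultimately show ?thesis using v(2) by (simp add: gap_words_iff)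
qed

text \<open>Both \<open>g\<close> and \<open>w\<close> are suffixes of \<open>w @ g\<close>, and
  \<open>min_gap w\<close> is a suffix of \<open>w\<close>. It is not longer than \<open>g\<close>
  because \<open>length g\<close> is a positive position of an occurrence.\<close>

lemma gap_words_suffix:
  assumes "w \<noteq> []" and "g \<in> gap_words b w"
  shows "suffix (min_gap w) g"
proof -
  have occ: "occurs_at w (w @ g) (length g)" and "g \<noteq> []"
    using assms(2) by (auto simp: gap_words_iff)
  hence le: "length (min_gap w) \<le> length g"
    using length_min_gap_le_occurrence[OF assms(1)] by simp
  have "suffix (min_gap w) w" using min_gap_split[OF assms(1)] by (metis suffixI)
  hence "suffix (min_gap w) (w @ g)" using occ suffix_order.trans by (auto simp: occurs_at_end)
  thus ?thesis using le by (metis suffix_appendI suffix_order.refl suffix_length_suffix)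
qed

subsection \<open>The gap laws and their self-similarity\<close>

text \<open>The passage from extended non-negative integrals, in which the laws are formulated, to
  real sums over the gap words.\<close>

lemma nn_integral_count_space_infsum:
  fixes f :: "'a \<Rightarrow> real"
  assumes "\<And>x. x \<in> A \<Longrightarrow> f x \<ge> 0" and "f summable_on A"
  shows "(\<integral>\<^sup>+x. ennreal (f x) \<partial>count_space A) = ennreal (infsum f A)"
proof -
  have "(\<lambda>x. norm (f x)) summable_on A"
    using assms by (subst summable_on_cong[of A _ f]) auto
  hence "Infinite_Set_Sum.abs_summable_on f A" using abs_summable_equivalent by blast
  thus ?thesis using assms(1) by (simp add: nn_integral_conv_infsetsum infsetsum_infsum)
qed

section \<open>Sums of powers over the gap words and the eigenvalues\<close>

locale gap_setting =
  fixes b :: nat and w :: "nat list"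
  assumes b: "b > 1" and w: "w \<noteq> []" "w \<in> lists {..<b}"
begin

abbreviation G where "G \<equiv> gap_words b w"
abbreviation s where "s \<equiv> min_gap w"
abbreviation xw where "xw \<equiv> center b w"

definition \<beta> where "\<beta> = 1 / real b"
definition R where "R = max xw (1 - xw)"
text \<open>The values of \<open>lam\<close> at integers, with natural powers in place of
  \<open>powr\<close>; see \<open>lam_eq\<close>.\<close>

definition \<Lambda> where "\<Lambda> n = (\<Sum>\<^sub>\<infinity>g\<in>G. \<beta> ^ (n * length g))"
definition \<phi> where "\<phi> g x = word_pt b g + x * \<beta> ^ length g"

lemma \<beta>_bounds: "0 < \<beta>" "\<beta> < 1" "\<beta> \<le> 1 / 2"
  using b by (auto simp: \<beta>_def field_simps)

lemma \<beta>_power: "0 < \<beta> ^ k" "\<beta> ^ k \<le> 1"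
  using \<beta>_bounds by (auto intro: power_le_one)

lemma \<beta>_power_half: "k > 0 \<Longrightarrow> \<beta> ^ k \<le> 1 / 2"
  using \<beta>_bounds power_decreasing[of 1 k \<beta>] by auto

lemma gap_lists: "g \<in> G \<Longrightarrow> g \<in> lists {..<b}" and gap_ne: "g \<in> G \<Longrightarrow> g \<noteq> []"
  by (auto simp: gap_words_def)

lemma s_gap: "s \<in> G"
  by (rule min_gap_in_gap_words[OF w])

lemma length_s: "length s > 0"
  using gap_ne[OF s_gap] by simp

lemma powr_eq: "real b powr (- real n * real k) = \<beta> ^ (n * k)"
proof -
  have "real b powr (- real n * real k) = real b powr (- real (n * k))" by simp
  also have "\<dots> = inverse (real b ^ (n * k))" using b by (simp add: powr_minus powr_realpow del: of_nat_mult)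
  finally show ?thesis by (simp add: \<beta>_def power_one_over inverse_eq_divide)
qed

lemma lam_eq: "lam b w (real n) = \<Lambda> n"
  unfolding lam_def \<Lambda>_def by (intro infsum_cong) (rule powr_eq)

lemma weight_summable:
  assumes "n \<ge> 1"
  shows "(\<lambda>g. \<beta> ^ (n * length g)) summable_on G"
proof (rule summable_on_comparison_test)
  show "(\<lambda>g. \<beta> ^ length g) summable_on G"
    unfolding \<beta>_def using b by (intro gap_words_summable) simp
  show "\<beta> ^ (n * length g) \<le> \<beta> ^ length g" for g
    using \<beta>_bounds assms by (intro power_decreasing) auto
qed (use \<beta>_bounds in auto)

text \<open>Only the term of the shortest gap word is kept.\<close>

lemma \<Lambda>_lower: "n \<ge> 1 \<Longrightarrow> \<beta> ^ (n * length s) \<le> \<Lambda> n"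
  using infsum_mono_neutral[of "\<lambda>g. \<beta> ^ (n * length g)" "{s}" "\<lambda>g. \<beta> ^ (n * length g)" G]
    weight_summable[of n] s_gap \<beta>_bounds by (simp add: \<Lambda>_def)

lemma \<Lambda>_pos: "n \<ge> 1 \<Longrightarrow> \<Lambda> n > 0"
  using \<Lambda>_lower[of n] \<beta>_power(1)[of "n * length s"] by linarith

text \<open>Gap words are non-empty, so raising the index multiplies each term by at most
  \<open>\<beta>\<close>.\<close>

lemma \<Lambda>_Suc: 
  assumes "n \<ge> 1"
  shows "\<Lambda> (Suc n) \<le> \<beta> * \<Lambda> n"
proof -
  have "\<Lambda> (Suc n) \<le> (\<Sum>\<^sub>\<infinity>g\<in>G. \<beta> * \<beta> ^ (n * length g))"
    unfolding \<Lambda>_def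
  proof (intro infsum_mono)
    fix g assume "g \<in> G"
    hence "length g \<ge> 1" using gap_ne[of g] by (cases g) auto
    thus "\<beta> ^ (Suc n * length g) \<le> \<beta> * \<beta> ^ (n * length g)"
      using \<beta>_bounds power_decreasing[of "Suc (n * length g)" "Suc n * length g" \<beta>] by simp
  qed (use assms in \<open>auto intro!: summable_on_cmult_right weight_summable simp del: mult_Suc\<close>)
  thus ?thesis by (simp add: \<Lambda>_def infsum_cmult_right')
qed

text \<open>Each step at least halves the sum, as \<open>\<beta> \<le> 1/2\<close>. Hence the
  eigenvalues are distinct, which will single out the eigenpolynomials.\<close>

lemma \<Lambda>_half:
  assumes "1 \<le> n" "n < m"
  shows "\<Lambda> m \<le> \<Lambda> n / 2"
  using assms(2)
proof (induction m)
  case (Suc m)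
  have step: "\<Lambda> (Suc m) \<le> \<Lambda> m / 2" 
  proof -
    have "m \<ge> 1" using Suc.prems assms(1) by simp
    thus ?thesis using \<Lambda>_Suc[of m] \<Lambda>_pos[of m] \<beta>_bounds mult_right_mono[of \<beta> "1/2" "\<Lambda> m"] by linarith
  qed
  show ?case
  proof (cases "n = m")
    case False
    thus ?thesis using Suc step \<Lambda>_pos[OF assms(1)] by simp
  qed (use step in simp)
qed simp

lemma \<Lambda>_inj: "1 \<le> n \<Longrightarrow> 1 \<le> m \<Longrightarrow> \<Lambda> n = \<Lambda> m \<Longrightarrow> n = m"
  using \<Lambda>_half[of n m] \<Lambda>_half[of m n] \<Lambda>_pos[of n] by (cases n m rule: linorder_cases) auto

section \<open>The laws of the gap words and of the random point\<close>

lemma prob_space_gap_law: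
  assumes "n \<ge> 1"
  shows "prob_space (gap_law b w n)"
proof
  have "emeasure (gap_law b w n) (space (gap_law b w n))
          = (\<integral>\<^sup>+g. ennreal (\<beta> ^ (n * length g) / \<Lambda> n) \<partial>count_space G)"
  proof -
    have "emeasure (gap_law b w n) G
        = (\<integral>\<^sup>+g. ennreal (\<beta> ^ (n * length g) / \<Lambda> n) * indicator G g \<partial>count_space G)"
      unfolding gap_law_def lam_eq powr_eq point_measure_def by (subst emeasure_density) auto
    also have "\<dots> = (\<integral>\<^sup>+g. ennreal (\<beta> ^ (n * length g) / \<Lambda> n) \<partial>count_space G)"
      by (intro nn_integral_cong) simp
    finally show ?thesis by (simp add: gap_law_def space_point_measure)
  qed
  also have "\<dots> = ennreal (\<Sum>\<^sub>\<infinity>g\<in>G. \<beta> ^ (n * length g) / \<Lambda> n)"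
  proof (intro nn_integral_count_space_infsum)
    show "0 \<le> \<beta> ^ (n * length g) / \<Lambda> n" for g
      using \<Lambda>_pos[OF assms] \<beta>_bounds(1) by simp
    show "(\<lambda>g. \<beta> ^ (n * length g) / \<Lambda> n) summable_on G"
      unfolding divide_inverse by (intro summable_on_cmult_left weight_summable assms)
  qed
  also have "(\<Sum>\<^sub>\<infinity>g\<in>G. \<beta> ^ (n * length g) / \<Lambda> n) = 1"
    using \<Lambda>_pos[OF assms] by (simp add: divide_inverse infsum_cmult_left') (simp add: \<Lambda>_def)
  finally show "emeasure (gap_law b w n) (space (gap_law b w n)) = 1" by simp
qed

lemma space_gap_law [simp]: "space (gap_law b w n) = G"
  and measurable_gap_law: "f \<in> borel_measurable (gap_law b w n)"
  by (simp_all add: gap_law_def space_point_measure)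

abbreviation P where "P S \<equiv> stream_pt b (flat S)"

lemma flat_streams:
  assumes "S \<in> streams G"
  shows "flat S \<in> streams {..<b}"
proof -
  have "sset S \<subseteq> G" using assms by (simp add: streams_iff_sset)
  hence "sset (flat S) \<subseteq> {..<b}"
    by (subst sset_flat) (use gap_ne gap_lists in \<open>auto simp: subset_iff\<close>)
  thus ?thesis by (simp add: streams_iff_sset)
qed

lemma P_bounds: "S \<in> streams G \<Longrightarrow> 0 \<le> P S" "S \<in> streams G \<Longrightarrow> P S \<le> 1"
  using stream_pt_bounds[OF flat_streams b] by auto

lemma P_Stream:
  assumes "g \<in> G" "S \<in> streams G"
  shows "P (g ## S) = \<phi> g (P S)"
  using stream_pt_shift[OF gap_lists[OF assms(1)] flat_streams[OF assms(2)] b] gap_ne[OF assms(1)]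
  by (simp add: \<phi>_def \<beta>_def field_simps)

lemma \<phi>_diff: "\<phi> g x - \<phi> g y = \<beta> ^ length g * (x - y)"
  by (simp add: \<phi>_def algebra_simps)

lemma \<phi>_bounds:
  assumes "g \<in> lists {..<b}" "x \<in> {0..1}"
  shows "\<phi> g x \<in> {0..1}"
proof -
  have "\<phi> g x \<le> 1 - \<beta> ^ length g + 1 * \<beta> ^ length g"
    unfolding \<phi>_def using assms word_pt_le[OF assms(1)] b \<beta>_bounds
    by (intro add_mono mult_right_mono) (auto simp: \<beta>_def power_divide)
  moreover have "\<phi> g x \<ge> 0" using assms word_pt_nonneg[of b g] \<beta>_bounds by (simp add: \<phi>_def)
  ultimately show ?thesis by simp
qed

text \<open>The point obtained from the first \<open>k\<close> words, with \<open>0\<close> in place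
  of the remaining tail. It depends on finitely many coordinates, so its measurability is clear, and
  \<open>P\<close> is its limit.\<close>

primrec P_approx :: "nat \<Rightarrow> nat list stream \<Rightarrow> real" where
  "P_approx 0 S = 0"
| "P_approx (Suc k) S = \<phi> (shd S) (P_approx k (stl S))"

text \<open>The two points differ by at most 1 in the tail, and each of the \<open>k\<close> maps
  contracts by at least \<open>\<beta>\<close> because its word is non-empty.\<close>

lemma P_approx_dist: "S \<in> streams G \<Longrightarrow> \<bar>P_approx k S - P S\<bar> \<le> \<beta> ^ k"
proof (induction k arbitrary: S)
  case (Suc k)
  obtain g S' where S: "S = g ## S'" by (cases S)
  have gS: "g \<in> G" "S' \<in> streams G" using Suc.prems S by (auto simp: streams_Stream)
  have "length g \<ge> 1" using gap_ne[OF gS(1)] by (cases g) auto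
  hence "\<beta> ^ length g \<le> \<beta> ^ 1" using \<beta>_bounds by (intro power_decreasing) auto
  hence "\<beta> ^ length g * \<bar>P_approx k S' - P S'\<bar> \<le> \<beta> ^ 1 * \<beta> ^ k"
    using Suc.IH[OF gS(2)] \<beta>_bounds by (intro mult_mono) auto
  moreover have "\<bar>P_approx (Suc k) S - P S\<bar> = \<beta> ^ length g * \<bar>P_approx k S' - P S'\<bar>"
    unfolding S using P_Stream[OF gS] \<beta>_bounds by (simp add: \<phi>_diff abs_mult del: flat_Stream)
  ultimately show ?case by simp
qed (use P_bounds in fastforce)

lemma P_measurable [measurable]: "P \<in> borel_measurable (stream_space (gap_law b w n))"
proof (rule borel_measurable_LIMSEQ_real)
  have [measurable]: "word_pt b \<in> borel_measurable (gap_law b w n)"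
    "(\<lambda>g. \<beta> ^ length g) \<in> borel_measurable (gap_law b w n)"
    by (auto simp: measurable_gap_law)
  show "P_approx k \<in> borel_measurable (stream_space (gap_law b w n))" for k
  proof (induction k)
    case (Suc k)
    note [measurable] = Suc
    show ?case unfolding P_approx.simps \<phi>_def by measurable
  qed simp
  fix S assume "S \<in> space (stream_space (gap_law b w n))"
  hence S: "S \<in> streams G" by (simp add: space_stream_space)
  have "(\<lambda>k. P_approx k S - P S) \<longlonglongrightarrow> 0"
  proof (rule tendsto_0_le[where K = 1])
    show "(\<lambda>k. \<beta> ^ k) \<longlonglongrightarrow> 0" using \<beta>_bounds by (intro LIMSEQ_power_zero) auto
  qed (use P_approx_dist[OF S] \<beta>_bounds in auto)
  thus "(\<lambda>k. P_approx k S) \<longlonglongrightarrow> P S" by (rule LIM_zero_cancel)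
qed

lemma sets_nu [simp, measurable_cong]: "sets (nu b w n) = sets borel"
  and space_nu [simp]: "space (nu b w n) = UNIV"
  by (simp_all add: nu_def)

lemma prob_space_nu:
  assumes "n \<ge> 1"
  shows "prob_space (nu b w n)"
proof -
  interpret prob_space "gap_law b w n" by (rule prob_space_gap_law[OF assms])
  interpret S: prob_space "stream_space (gap_law b w n)" by (rule prob_space_stream_space)
  show ?thesis unfolding nu_def by (rule S.prob_space_distr) simp
qed

section \<open>Integrals against \<open>nu\<close> and stationarity\<close>

lemma AE_nu: "AE t in nu b w n. t \<in> {0..1}"
  unfolding nu_def by (subst AE_distr_iff) (auto simp: space_stream_space P_bounds intro!: AE_I2)

lemma AE_unit: "(\<And>t. t \<in> {0..1} \<Longrightarrow> Q t) \<Longrightarrow> AE t in nu b w n. Q t"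
  by (rule eventually_mono[OF AE_nu])

text \<open>The first word of the i.i.d. sequence is split off: the remaining sequence has the same
  law and is independent of it, and prefixing \<open>g\<close> acts on the point by
  \<open>\<phi> g\<close>.\<close>

lemma nn_stationary:
  assumes n: "n \<ge> 1" and [measurable]: "h \<in> borel_measurable borel"
  shows "(\<integral>\<^sup>+t. h t \<partial>nu b w n) =
    (\<integral>\<^sup>+g. ennreal (\<beta> ^ (n * length g) / \<Lambda> n) * (\<integral>\<^sup>+t. h (\<phi> g t) \<partial>nu b w n) \<partial>count_space G)"
proof -
  interpret prob_space "gap_law b w n" by (rule prob_space_gap_law[OF n])
  let ?S = "stream_space (gap_law b w n)"
  have [measurable]: "\<phi> g \<in> borel_measurable borel" for g unfolding \<phi>_def by measurable
  have "(\<integral>\<^sup>+t. h t \<partial>nu b w n) = (\<integral>\<^sup>+S. h (P S) \<partial>?S)"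
    by (simp add: nu_def nn_integral_distr)
  also have "\<dots> = (\<integral>\<^sup>+g. (\<integral>\<^sup>+S. h (P (g ## S)) \<partial>?S) \<partial>gap_law b w n)"
    by (rule nn_integral_stream_space) measurable
  also have "\<dots> = (\<integral>\<^sup>+g. (\<integral>\<^sup>+S. h (\<phi> g (P S)) \<partial>?S) \<partial>gap_law b w n)"
    by (intro nn_integral_cong) (simp add: space_stream_space P_Stream del: flat_Stream)
  also have "\<dots> = (\<integral>\<^sup>+g. (\<integral>\<^sup>+t. h (\<phi> g t) \<partial>nu b w n) \<partial>gap_law b w n)"
    by (simp add: nu_def nn_integral_distr)
  also have "\<dots> = (\<integral>\<^sup>+g. ennreal (\<beta> ^ (n * length g) / \<Lambda> n) * (\<integral>\<^sup>+t. h (\<phi> g t) \<partial>nu b w n) \<partial>count_space G)"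
    unfolding gap_law_def lam_eq powr_eq point_measure_def by (subst nn_integral_density) auto
  finally show ?thesis .
qed

definition bounded_unit :: "(real \<Rightarrow> real) \<Rightarrow> bool" where
  "bounded_unit h \<longleftrightarrow> h \<in> borel_measurable borel \<and> (\<exists>C. \<forall>t\<in>{0..1}. \<bar>h t\<bar> \<le> C)"

lemma bounded_unitI:
  assumes "h \<in> borel_measurable borel" "\<And>t. t \<in> {0..1} \<Longrightarrow> \<bar>h t\<bar> \<le> C"
  shows "bounded_unit h"
  using assms unfolding bounded_unit_def by blast

lemma bounded_unit_\<phi>:
  assumes "bounded_unit h" "g \<in> G"
  shows "bounded_unit (\<lambda>t. h (\<phi> g t))"
proof -
  obtain C where [measurable]: "h \<in> borel_measurable borel" and C: "\<And>t. t \<in> {0..1} \<Longrightarrow> \<bar>h t\<bar> \<le> C"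
    using assms(1) unfolding bounded_unit_def by blast
  show ?thesis
  proof (rule bounded_unitI)
    show "(\<lambda>t. h (\<phi> g t)) \<in> borel_measurable borel" unfolding \<phi>_def by measurable
    show "\<bar>h (\<phi> g t)\<bar> \<le> C" if "t \<in> {0..1}" for t
      by (intro C \<phi>_bounds gap_lists assms(2) that)
  qed
qed

lemma integrable_nu:
  assumes "n \<ge> 1" and "bounded_unit h"
  shows "integrable (nu b w n) h"
proof -
  interpret prob_space "nu b w n" by (rule prob_space_nu[OF assms(1)])
  obtain C where [measurable]: "h \<in> borel_measurable borel" and C: "\<And>t. t \<in> {0..1} \<Longrightarrow> \<bar>h t\<bar> \<le> C"
    using assms(2) unfolding bounded_unit_def by blast
  show ?thesis
    by (rule integrable_const_bound[of _ C]) (auto intro: AE_unit C)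
qed

abbreviation E :: "nat \<Rightarrow> (real \<Rightarrow> real) \<Rightarrow> real" where "E n h \<equiv> integral\<^sup>L (nu b w n) h"

lemma E_mono:
  assumes "n \<ge> 1" "bounded_unit h" "bounded_unit k" "\<And>t. t \<in> {0..1} \<Longrightarrow> h t \<le> k t"
  shows "E n h \<le> E n k"
  by (intro integral_mono_AE integrable_nu assms) (auto intro!: AE_unit assms(4))

lemma E_nonneg:
  assumes "\<And>t. t \<in> {0..1} \<Longrightarrow> 0 \<le> h t"
  shows "0 \<le> E n h"
  by (intro integral_nonneg_AE AE_unit assms)

lemma E_const: "n \<ge> 1 \<Longrightarrow> E n (\<lambda>t. c) = c"
  using prob_space.prob_space[OF prob_space_nu[of n]] by simp

lemma E_\<phi>_bound:
  assumes n: "n \<ge> 1" and h: "bounded_unit h" and C: "\<And>t. t \<in> {0..1} \<Longrightarrow> \<bar>h t\<bar> \<le> C" and g: "g \<in> G"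
  shows "\<bar>E n (\<lambda>t. h (\<phi> g t))\<bar> \<le> C"
proof -
  have C': "\<bar>h (\<phi> g t)\<bar> \<le> C" if "t \<in> {0..1}" for t by (intro C \<phi>_bounds gap_lists g that)
  have "bounded_unit (\<lambda>t. \<bar>h (\<phi> g t)\<bar>)"
    using bounded_unit_\<phi>[OF h g] unfolding bounded_unit_def by auto
  moreover have "bounded_unit (\<lambda>t. C)" by (rule bounded_unitI[of _ "\<bar>C\<bar>"]) auto
  ultimately have "E n (\<lambda>t. \<bar>h (\<phi> g t)\<bar>) \<le> E n (\<lambda>t. C)" using C' n by (intro E_mono) auto
  thus ?thesis using integral_abs_bound[of "nu b w n" "\<lambda>t. h (\<phi> g t)"] E_const[OF n, of C] by linarith
qed

lemma stationary_summable:
  assumes n: "n \<ge> 1" and h: "bounded_unit h"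
  shows "(\<lambda>g. \<beta> ^ (n * length g) * E n (\<lambda>t. h (\<phi> g t))) summable_on G"
proof -
  obtain C where C: "\<And>t. t \<in> {0..1} \<Longrightarrow> \<bar>h t\<bar> \<le> C" using h unfolding bounded_unit_def by blast
  have "(\<lambda>g. \<beta> ^ (n * length g) * C) summable_on G"
    by (intro summable_on_cmult_left weight_summable n)
  hence "(\<lambda>g. norm (\<beta> ^ (n * length g) * E n (\<lambda>t. h (\<phi> g t)))) summable_on G"
  proof (rule summable_on_comparison_test)
    fix g assume g: "g \<in> G"
    show "norm (\<beta> ^ (n * length g) * E n (\<lambda>t. h (\<phi> g t))) \<le> \<beta> ^ (n * length g) * C"
      using \<beta>_bounds E_\<phi>_bound[OF n h C g] by (simp add: abs_mult mult_left_mono)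
  qed auto
  thus ?thesis by (rule abs_summable_summable)
qed

text \<open>For a non-negative function both sides are finite, so the identity of extended integrals
  can be read in the reals.\<close>

lemma stationary_nonneg:
  assumes n: "n \<ge> 1" and h: "bounded_unit h" and pos: "\<And>t. t \<in> {0..1} \<Longrightarrow> 0 \<le> h t"
  shows "\<Lambda> n * E n h = (\<Sum>\<^sub>\<infinity>g\<in>G. \<beta> ^ (n * length g) * E n (\<lambda>t. h (\<phi> g t)))"
proof -
  have [measurable]: "h \<in> borel_measurable borel" using h by (simp add: bounded_unit_def)
  have pos': "0 \<le> h (\<phi> g t)" if "g \<in> G" "t \<in> {0..1}" for g t
    by (intro pos \<phi>_bounds gap_lists that)
  have terms_nonneg: "0 \<le> \<beta> ^ (n * length g) * E n (\<lambda>t. h (\<phi> g t))" if "g \<in> G" for g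
    using \<beta>_bounds(1) pos' that by (intro mult_nonneg_nonneg E_nonneg) auto
  have "ennreal (E n h) = (\<integral>\<^sup>+t. ennreal (h t) \<partial>nu b w n)"
    by (intro nn_integral_eq_integral[symmetric] integrable_nu n h)
       (auto intro: AE_unit pos)
  also have "\<dots> = (\<integral>\<^sup>+g. ennreal (\<beta> ^ (n * length g) / \<Lambda> n) *
                    (\<integral>\<^sup>+t. ennreal (h (\<phi> g t)) \<partial>nu b w n) \<partial>count_space G)"
    by (intro nn_stationary n) measurable
  also have "\<dots> = (\<integral>\<^sup>+g. ennreal (\<beta> ^ (n * length g) * E n (\<lambda>t. h (\<phi> g t)) * inverse (\<Lambda> n)) \<partial>count_space G)"
  proof (intro nn_integral_cong)
    fix g assume "g \<in> space (count_space G)"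
    hence g: "g \<in> G" by simp
    have E_eq: "(\<integral>\<^sup>+t. ennreal (h (\<phi> g t)) \<partial>nu b w n) = ennreal (E n (\<lambda>t. h (\<phi> g t)))"
      by (intro nn_integral_eq_integral integrable_nu n bounded_unit_\<phi> h g)
         (auto intro: AE_unit pos' g)
    show "ennreal (\<beta> ^ (n * length g) / \<Lambda> n) * (\<integral>\<^sup>+t. ennreal (h (\<phi> g t)) \<partial>nu b w n)
        = ennreal (\<beta> ^ (n * length g) * E n (\<lambda>t. h (\<phi> g t)) * inverse (\<Lambda> n))"
    proof -
      have "0 \<le> E n (\<lambda>t. h (\<phi> g t))" by (intro E_nonneg pos' g)
      moreover have "0 \<le> \<beta> ^ (n * length g) / \<Lambda> n" using \<Lambda>_pos[OF n] \<beta>_bounds(1) by simp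
      ultimately have "ennreal (\<beta> ^ (n * length g) / \<Lambda> n) * ennreal (E n (\<lambda>t. h (\<phi> g t)))
          = ennreal (\<beta> ^ (n * length g) / \<Lambda> n * E n (\<lambda>t. h (\<phi> g t)))"
        by (intro ennreal_mult[symmetric])
      thus ?thesis unfolding E_eq by (simp add: divide_inverse mult_ac)
    qed
  qed
  also have "\<dots> = ennreal ((\<Sum>\<^sub>\<infinity>g\<in>G. \<beta> ^ (n * length g) * E n (\<lambda>t. h (\<phi> g t)) * inverse (\<Lambda> n)))"
  proof (rule nn_integral_count_space_infsum)
    show "0 \<le> \<beta> ^ (n * length g) * E n (\<lambda>t. h (\<phi> g t)) * inverse (\<Lambda> n)" if "g \<in> G" for g
      using terms_nonneg[OF that] \<Lambda>_pos[OF n] by (intro mult_nonneg_nonneg[of "_ * _"]) auto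
    show "(\<lambda>g. \<beta> ^ (n * length g) * E n (\<lambda>t. h (\<phi> g t)) * inverse (\<Lambda> n)) summable_on G"
      by (rule summable_on_cmult_left[OF stationary_summable[OF n h]])
  qed
  also have "(\<Sum>\<^sub>\<infinity>g\<in>G. \<beta> ^ (n * length g) * E n (\<lambda>t. h (\<phi> g t)) * inverse (\<Lambda> n))
      = (\<Sum>\<^sub>\<infinity>g\<in>G. \<beta> ^ (n * length g) * E n (\<lambda>t. h (\<phi> g t))) * inverse (\<Lambda> n)"
    by (rule infsum_cmult_left')
  finally have "E n h = (\<Sum>\<^sub>\<infinity>g\<in>G. \<beta> ^ (n * length g) * E n (\<lambda>t. h (\<phi> g t))) * inverse (\<Lambda> n)"
    using less_imp_le[OF \<Lambda>_pos[OF n]]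
    by (subst (asm) ennreal_inj) (auto intro!: mult_nonneg_nonneg infsum_nonneg terms_nonneg E_nonneg pos)
  thus ?thesis using \<Lambda>_pos[OF n] by (simp add: field_simps)
qed

lemma bounded_unit_add_const: "bounded_unit h \<Longrightarrow> bounded_unit (\<lambda>t. h t + c)"
proof -
  assume "bounded_unit h"
  then obtain C where C: "h \<in> borel_measurable borel" "\<And>t. t \<in> {0..1} \<Longrightarrow> \<bar>h t\<bar> \<le> C"
    unfolding bounded_unit_def by blast
  show ?thesis
  proof (rule bounded_unitI[of _ "C + \<bar>c\<bar>"])
    show "\<bar>h t + c\<bar> \<le> C + \<bar>c\<bar>" if "t \<in> {0..1}" for t using C(2)[OF that] by linarith
  qed (use C(1) in auto)
qed

text \<open>Adding the bound \<open>C\<close> makes the function non-negative, and the constant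
  contributes \<open>\<Lambda> n * C\<close> to either side.\<close>

lemma stationary:
  assumes n: "n \<ge> 1" and h: "bounded_unit h"
  shows "\<Lambda> n * E n h = (\<Sum>\<^sub>\<infinity>g\<in>G. \<beta> ^ (n * length g) * E n (\<lambda>t. h (\<phi> g t)))"
proof -
  obtain C where C: "\<And>t. t \<in> {0..1} \<Longrightarrow> \<bar>h t\<bar> \<le> C" using h unfolding bounded_unit_def by blast
  have E_add: "E n (\<lambda>t. k t + C) = E n k + C" if "bounded_unit k" for k
    using integrable_nu[OF n that] E_const[OF n, of C] integrable_nu[OF n bounded_unitI[of "\<lambda>_. C" "\<bar>C\<bar>"]]
    by (subst Bochner_Integration.integral_add) auto
  have "\<Lambda> n * E n (\<lambda>t. h t + C) = (\<Sum>\<^sub>\<infinity>g\<in>G. \<beta> ^ (n * length g) * E n (\<lambda>t. h (\<phi> g t) + C))"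
    using C by (intro stationary_nonneg n bounded_unit_add_const h) (force simp: abs_le_iff)
  also have "\<dots> = (\<Sum>\<^sub>\<infinity>g\<in>G. \<beta> ^ (n * length g) * E n (\<lambda>t. h (\<phi> g t)) + \<beta> ^ (n * length g) * C)"
    by (intro infsum_cong) (simp add: E_add bounded_unit_\<phi>[OF h] distrib_left)
  also have "\<dots> = (\<Sum>\<^sub>\<infinity>g\<in>G. \<beta> ^ (n * length g) * E n (\<lambda>t. h (\<phi> g t))) + \<Lambda> n * C"
    by (subst infsum_add)
       (auto intro!: stationary_summable n h summable_on_cmult_left weight_summable simp: infsum_cmult_left' \<Lambda>_def)
  finally show ?thesis by (simp add: E_add[OF h] distrib_left)
qed

end

subsection \<open>Concentration at the centre\<close>

context gap_setting
begin

text \<open>The ratio with which \<open>\<phi> s\<close> contracts towards its fixed point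
  \<open>xw\<close>.\<close>

definition \<theta> where "\<theta> = \<beta> ^ length s"

lemma \<theta>_bounds: "0 < \<theta>" "\<theta> \<le> 1 / 2"
  using \<beta>_power_half[OF length_s] \<beta>_bounds by (auto simp: \<theta>_def)

lemma \<phi>_append: "\<phi> (g @ h) x = \<phi> g (\<phi> h x)"
  using b by (simp add: \<phi>_def word_pt_append \<beta>_def power_add field_simps)

lemma cycle_s: "cycle s \<in> streams {..<b}"
  using length_s gap_lists[OF s_gap] by (auto simp: streams_iff_sset)

lemma xw_bounds: "0 \<le> xw" "xw \<le> 1"
  using stream_pt_bounds[OF cycle_s b] by (auto simp: center_def)

lemma R_bounds: "0 < R" "R \<le> 1"
  using xw_bounds by (auto simp: R_def)

lemma dist_xw_le: "t \<in> {0..1} \<Longrightarrow> \<bar>t - xw\<bar> \<le> R"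
  using xw_bounds by (auto simp: R_def)

text \<open>The periodic sequence of digits that represents \<open>xw\<close> does not change when
  \<open>s\<close> is put in front.\<close>

lemma \<phi>_s_xw: "\<phi> s xw = xw"
proof -
  have "cycle s = s @- cycle s" using length_s by (intro cycle_decomp) auto
  hence "xw = word_pt b s + xw / real b ^ length s"
    using stream_pt_shift[OF gap_lists[OF s_gap] cycle_s b] by (simp add: center_def)
  thus ?thesis by (simp add: \<phi>_def \<beta>_def power_divide)
qed

lemma gap_decomp:
  assumes "g \<in> G"
  obtains h where "g = h @ s" "h \<in> lists {..<b}"
proof -
  obtain h where h: "g = h @ s" using gap_words_suffix[OF w(1) assms] by (auto simp: suffix_def)
  moreover have "h \<in> lists {..<b}" using h gap_lists[OF assms] by simp
  ultimately show ?thesis using that by blast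
qed

text \<open>Since \<open>\<phi> s\<close> fixes \<open>xw\<close>, the image differs from
  \<open>\<phi> h xw\<close> by \<open>\<beta> ^ length h * \<theta> * (x - xw)\<close>. In turn,
  \<open>\<phi> h xw - xw\<close> lies between \<open>- xw\<close> and \<open>1 - xw\<close> times
  \<open>1 - \<beta> ^ length h\<close>, hence the factor \<open>R\<close>.\<close>

lemma \<phi>_gap_dist:
  assumes "h \<in> lists {..<b}"
  shows "\<bar>\<phi> (h @ s) x - xw\<bar> \<le> R * (1 - \<beta> ^ length h) + \<beta> ^ length h * \<theta> * \<bar>x - xw\<bar>"
proof -
  have "\<phi> (h @ s) x - xw = \<phi> h (\<phi> s x) - \<phi> h xw + (\<phi> h xw - xw)" by (simp add: \<phi>_append)
  also have "\<phi> h (\<phi> s x) - \<phi> h xw = \<beta> ^ length h * (\<phi> s x - \<phi> s xw)"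
    by (simp add: \<phi>_s_xw \<phi>_diff)
  also have "\<dots> = \<beta> ^ length h * \<theta> * (x - xw)" by (simp add: \<phi>_diff \<theta>_def)
  finally have "\<bar>\<phi> (h @ s) x - xw\<bar> \<le> \<bar>\<beta> ^ length h * \<theta> * (x - xw)\<bar> + \<bar>\<phi> h xw - xw\<bar>" by linarith
  also have "\<bar>\<beta> ^ length h * \<theta> * (x - xw)\<bar> = \<beta> ^ length h * \<theta> * \<bar>x - xw\<bar>"
    using \<beta>_bounds \<theta>_bounds by (simp add: abs_mult)
  also have "\<bar>\<phi> h xw - xw\<bar> \<le> R * (1 - \<beta> ^ length h)"
  proof -
    have le: "word_pt b h \<le> 1 - \<beta> ^ length h"
      using word_pt_le[OF assms] b by (simp add: \<beta>_def power_divide)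
    have eq: "\<phi> h xw - xw = word_pt b h - xw * (1 - \<beta> ^ length h)" by (simp add: \<phi>_def algebra_simps)
    have "xw * (1 - \<beta> ^ length h) \<le> R * (1 - \<beta> ^ length h)"
      using \<beta>_power by (intro mult_right_mono) (auto simp: R_def)
    moreover have "(1 - xw) * (1 - \<beta> ^ length h) \<le> R * (1 - \<beta> ^ length h)"
      using \<beta>_power by (intro mult_right_mono) (auto simp: R_def)
    ultimately show ?thesis using le word_pt_nonneg[of b h] unfolding eq
      by (simp add: algebra_simps abs_le_iff)
  qed
  finally show ?thesis by simp
qed

text \<open>From \<open>R < \<rho>\<close> the base stays above \<open>1 - R / \<rho> > 0\<close> on
  the unit interval. The factor \<open>c\<close> will be \<open>1\<close> or
  \<open>\<theta>\<close>.\<close>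

lemma bounded_unit_inverse_power:
  assumes "R < \<rho>"  and "0 \<le> c" "c \<le> 1"
  shows "bounded_unit (\<lambda>t. inverse ((1 - c * (\<bar>t - xw\<bar> / \<rho>)) ^ n))"
proof (rule bounded_unitI)
  fix t :: real assume t: "t \<in> {0..1}"
  have "c * (\<bar>t - xw\<bar> / \<rho>) \<le> 1 * (R / \<rho>)"
    using assms R_bounds dist_xw_le[OF t] by (intro mult_mono divide_right_mono) auto
  hence "1 - c * (\<bar>t - xw\<bar> / \<rho>) \<ge> 1 - R / \<rho>" by simp
  moreover have "1 - R / \<rho> > 0" using assms R_bounds by simp
  ultimately show "\<bar>inverse ((1 - c * (\<bar>t - xw\<bar> / \<rho>)) ^ n)\<bar> \<le> inverse ((1 - R / \<rho>) ^ n)"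
    by (auto intro!: le_imp_inverse_le power_mono)
qed measurable

text \<open>
  A word of \<open>G\<close> of length \<open>length h + length s\<close> moves the point away from \<open>xw\<close> by a factor that its
  weight exactly compensates; the excess \<open>\<epsilon> = 1 - R / \<rho>\<close> makes the sum over \<open>h\<close> converge.
\<close>

lemma inverse_power_step:
  assumes \<rho>: "R < \<rho>" and h: "h \<in> lists {..<b}" and t: "t \<in> {0..1}" and n: "n \<ge> 1"
  shows "\<beta> ^ (n * length (h @ s)) * inverse ((1 - \<bar>\<phi> (h @ s) t - xw\<bar> / \<rho>) ^ n)
       \<le> \<theta> ^ n * (2 / (1 - R / \<rho>)) * \<beta> ^ length h * inverse ((1 - \<theta> * (\<bar>t - xw\<bar> / \<rho>)) ^ n)"
proof -
  define \<epsilon> where "\<epsilon> = 1 - R / \<rho>"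
  define y where "y = \<bar>t - xw\<bar> / \<rho>"
  define B where "B = \<beta> ^ length h"
  define p where "p = 1 - \<theta> * y"
  define q where "q = \<epsilon> / (2 * B)"
  \<comment> \<open>Chosen so that \<open>B * v = B * p + \<epsilon> * (1 - B)\<close> is the lower
    bound for \<open>1 - |\<phi> (h @ s) t - xw| / \<rho>\<close> that comes from
    \<open>\<phi>_gap_dist\<close>.\<close>
  define v where "v = p + 2 * q - \<epsilon>"
  have \<rho>0: "\<rho> > 0" using \<rho> R_bounds by linarith
  have \<epsilon>: "0 < \<epsilon>" "\<epsilon> \<le> 1" using \<rho> R_bounds \<rho>0 by (auto simp: \<epsilon>_def field_simps)
  have B: "0 < B" "B \<le> 1" using \<beta>_power by (auto simp: B_def)
  have y: "0 \<le> y" "y \<le> 1"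
    using dist_xw_le[OF t] \<rho> \<rho>0 by (auto simp: y_def field_simps)
  have "\<theta> * y \<le> 1 / 2 * 1" using y \<theta>_bounds by (intro mult_mono) auto
  hence p: "1 / 2 \<le> p" "p \<le> 1" using y \<theta>_bounds by (auto simp: p_def)
  have q: "q > 0" "2 * q \<ge> \<epsilon>" using \<epsilon> B by (auto simp: q_def field_simps mult_left_le)
  have "B * v = 1 - (R * (1 - B) + B * \<theta> * \<bar>t - xw\<bar>) / \<rho>"
    using B \<rho>0 by (simp add: v_def p_def q_def \<epsilon>_def y_def field_simps)
  also have "\<dots> \<le> 1 - \<bar>\<phi> (h @ s) t - xw\<bar> / \<rho>"
    using \<phi>_gap_dist[OF h, of t] \<rho>0 by (auto simp: B_def intro!: divide_right_mono)
  finally have u: "B * v \<le> 1 - \<bar>\<phi> (h @ s) t - xw\<bar> / \<rho>" .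
  have v: "v > 0" using p q by (simp add: v_def)
  \<comment> \<open>One factor \<open>q\<close> is extracted regardless of \<open>n\<close>; its
    inverse \<open>2 * B / \<epsilon>\<close> is what makes the sum over the words converge
    uniformly in \<open>n\<close>. The 2 in \<open>q\<close> leaves room to absorb
    \<open>\<epsilon>\<close>: for \<open>q \<le> 1\<close> one has \<open>v \<ge> p\<close>, and
    for \<open>q > 1\<close> one has \<open>v \<ge> q\<close>.\<close>
  have vn: "q * p ^ n \<le> v ^ n"
  proof (cases "q \<le> 1")
    case True
    have "q * p ^ n \<le> 1 * p ^ n" using True p by (intro mult_right_mono) auto
    also have "\<dots> \<le> v ^ n" using p q by (auto simp: v_def intro: power_mono)
    finally show ?thesis .
  next
    case False
    hence vq: "v \<ge> q" "v \<ge> 1" using p \<epsilon> by (auto simp: v_def)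
    have "q * p ^ n \<le> q * 1" using q p by (intro mult_left_mono power_le_one) auto
    also have "\<dots> \<le> v ^ 1" using vq by simp
    also have "\<dots> \<le> v ^ n" using vq n by (intro power_increasing) auto
    finally show ?thesis .
  qed
  \<comment> \<open>The weight is \<open>\<theta> ^ n * B ^ n\<close>, and \<open>B ^ n\<close>
    cancels against the power of \<open>B * v\<close>.\<close>
  have "\<beta> ^ (n * length (h @ s)) * inverse ((1 - \<bar>\<phi> (h @ s) t - xw\<bar> / \<rho>) ^ n)
      \<le> (\<theta> ^ n * B ^ n) * inverse ((B * v) ^ n)"
  proof (rule mult_mono)
    show "\<beta> ^ (n * length (h @ s)) \<le> \<theta> ^ n * B ^ n"
      by (simp add: \<theta>_def B_def power_add distrib_left mult.commute[of n] power_mult)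
    show "inverse ((1 - \<bar>\<phi> (h @ s) t - xw\<bar> / \<rho>) ^ n) \<le> inverse ((B * v) ^ n)"
      using u v B by (intro le_imp_inverse_le power_mono) auto
    show "0 \<le> inverse ((1 - \<bar>\<phi> (h @ s) t - xw\<bar> / \<rho>) ^ n)"
      using u mult_pos_pos[OF B(1) v] by simp
  qed (use \<theta>_bounds B in auto)
  also have "\<dots> = \<theta> ^ n * inverse (v ^ n)"
    using B by (simp add: power_mult_distrib)
  also have "\<dots> \<le> \<theta> ^ n * inverse (q * p ^ n)"
    using \<theta>_bounds vn q p by (intro mult_left_mono le_imp_inverse_le) auto
  also have "\<dots> = \<theta> ^ n * (2 / \<epsilon>) * B * inverse (p ^ n)"
    using \<epsilon> B by (simp add: q_def field_simps)
  finally show ?thesis by (simp add: \<epsilon>_def B_def p_def y_def)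
qed

text \<open>Stationarity and the one-step estimate give \<open>E n h \<le> D * E n k\<close>, where
  \<open>k\<close> has \<open>\<theta> * y\<close> in place of \<open>y = |t - xw| / \<rho>\<close>.
  As \<open>\<theta> \<le> 1/2\<close>, one has \<open>1 - y \<le> (1 - \<theta> * y) ^ 2\<close>,
  so \<open>k ^ 2 \<le> h\<close>. Then \<open>k \<le> h / (2 * D) + D / 2\<close> lets half of the
  finite number \<open>E n h\<close> be absorbed, which leaves the bound \<open>D ^ 2\<close> for
  every \<open>n\<close>.\<close>

lemma inverse_power_bound:
  assumes \<rho>: "R < \<rho>"
  obtains D where "D > 0" "\<And>n. n \<ge> 1 \<Longrightarrow> E n (\<lambda>t. inverse ((1 - \<bar>t - xw\<bar> / \<rho>) ^ n)) \<le> D"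
proof -
  define \<epsilon> where "\<epsilon> = 1 - R / \<rho>"
  have \<epsilon>: "\<epsilon> > 0" and \<rho>0: "\<rho> > 0" using \<rho> R_bounds by (auto simp: \<epsilon>_def)
  \<comment> \<open>The factor \<open>2 / \<epsilon>\<close> comes from
    \<open>inverse_power_step\<close>, \<open>1 / \<theta>\<close> turns
    \<open>\<beta> ^ length g'\<close> into \<open>\<beta> ^ length g\<close>, and
    \<open>\<Lambda> 1\<close> is the sum of the latter.\<close>
  define D where "D = 2 / \<epsilon> / \<theta> * \<Lambda> 1"
  have D: "D > 0" using \<epsilon> \<theta>_bounds \<Lambda>_pos[of 1] by (simp add: D_def)
  show ?thesis
  proof (rule that[of "D ^ 2"])
    fix n :: nat assume n: "n \<ge> 1"
    define h where "h t = inverse ((1 - \<bar>t - xw\<bar> / \<rho>) ^ n)" for t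
    define k where "k t = inverse ((1 - \<theta> * (\<bar>t - xw\<bar> / \<rho>)) ^ n)" for t
    have bh: "bounded_unit h" unfolding h_def using bounded_unit_inverse_power[OF \<rho>, of 1 n] by simp
    have bk: "bounded_unit k" unfolding k_def using \<theta>_bounds by (intro bounded_unit_inverse_power \<rho>) auto
    have "\<theta> ^ n * E n h \<le> \<Lambda> n * E n h"
    proof (intro mult_right_mono E_nonneg)
      fix t :: real assume "t \<in> {0..1}"
      thus "0 \<le> h t" using dist_xw_le[of t] \<rho> \<rho>0 by (simp add: h_def)
    next
      show "\<theta> ^ n \<le> \<Lambda> n" using \<Lambda>_lower[OF n] by (simp add: \<theta>_def power_mult mult.commute[of n])
    qed
    also have "\<dots> = (\<Sum>\<^sub>\<infinity>g\<in>G. \<beta> ^ (n * length g) * E n (\<lambda>t. h (\<phi> g t)))"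
      by (rule stationary[OF n bh])
    also have "\<dots> \<le> (\<Sum>\<^sub>\<infinity>g\<in>G. (\<theta> ^ n * (2 / \<epsilon> / \<theta>) * E n k) * \<beta> ^ (1 * length g))"
    proof (rule infsum_mono)
      fix g assume g: "g \<in> G"
      then obtain g' where g': "g = g' @ s" "g' \<in> lists {..<b}" by (rule gap_decomp)
      have "\<beta> ^ (n * length g) * E n (\<lambda>t. h (\<phi> g t)) = E n (\<lambda>t. \<beta> ^ (n * length g) * h (\<phi> g t))" by simp
      also have "\<dots> \<le> E n (\<lambda>t. \<theta> ^ n * (2 / \<epsilon>) * \<beta> ^ length g' * k t)"
      proof (intro E_mono n)
        have c: "bounded_unit (\<lambda>t. c * f t)" if "bounded_unit f" for c f
        proof -
          obtain C where C: "f \<in> borel_measurable borel" "\<And>t. t \<in> {0..1} \<Longrightarrow> \<bar>f t\<bar> \<le> C"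
            using \<open>bounded_unit f\<close> unfolding bounded_unit_def by blast
          show ?thesis by (rule bounded_unitI[of _ "\<bar>c\<bar> * C"]) (use C in \<open>auto simp: abs_mult intro!: mult_left_mono\<close>)
        qed
        show "bounded_unit (\<lambda>t. \<beta> ^ (n * length g) * h (\<phi> g t))" by (intro c bounded_unit_\<phi> bh g)
        show "bounded_unit (\<lambda>t. \<theta> ^ n * (2 / \<epsilon>) * \<beta> ^ length g' * k t)" by (intro c bk)
        fix t :: real assume "t \<in> {0..1}"
        thus "\<beta> ^ (n * length g) * h (\<phi> g t) \<le> \<theta> ^ n * (2 / \<epsilon>) * \<beta> ^ length g' * k t"
          unfolding g' h_def k_def \<epsilon>_def by (intro inverse_power_step \<rho> g' n)
      qed
      also have "\<dots> = \<theta> ^ n * (2 / \<epsilon>) * \<beta> ^ length g' * E n k" by simp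
      also have "\<beta> ^ length g' = \<beta> ^ length g / \<theta>" using \<beta>_bounds by (simp add: g' \<theta>_def power_add)
      finally show "\<beta> ^ (n * length g) * E n (\<lambda>t. h (\<phi> g t)) \<le> \<theta> ^ n * (2 / \<epsilon> / \<theta>) * E n k * \<beta> ^ (1 * length g)"
        by (simp add: mult_ac)
    qed (intro stationary_summable n bh summable_on_cmult_right weight_summable order_refl)+
    also have "\<dots> = \<theta> ^ n * (2 / \<epsilon> / \<theta>) * E n k * \<Lambda> 1"
      by (simp only: infsum_cmult_right' \<Lambda>_def)
    also have "\<dots> = \<theta> ^ n * (D * E n k)" by (simp add: D_def)
    finally have "E n h \<le> D * E n k" using \<theta>_bounds by simp
    also have "E n k \<le> E n (\<lambda>t. h t / (2 * D) + D / 2)"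
    proof (intro E_mono n bk bounded_unit_add_const)
      obtain C where C: "h \<in> borel_measurable borel" "\<And>t. t \<in> {0..1} \<Longrightarrow> \<bar>h t\<bar> \<le> C"
        using bh unfolding bounded_unit_def by blast
      show "bounded_unit (\<lambda>t. h t / (2 * D))"
        by (rule bounded_unitI[of _ "C / (2 * D)"]) (use C D in \<open>auto simp: abs_mult intro!: divide_right_mono\<close>)
      fix t :: real assume t: "t \<in> {0..1}"
      define y where "y = \<bar>t - xw\<bar> / \<rho>"
      have y: "0 \<le> y" "y < 1" using dist_xw_le[OF t] \<rho> \<rho>0 by (auto simp: y_def)
      have "1 - y \<le> 1 - 2 * \<theta> * y" using \<theta>_bounds y mult_right_mono[of "2 * \<theta>" 1 y] by simp
      also have "\<dots> \<le> (1 - \<theta> * y) ^ 2"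
        using zero_le_power2[of "\<theta> * y"] by (simp add: power2_eq_square algebra_simps)
      finally have "(1 - y) ^ n \<le> ((1 - \<theta> * y) ^ 2) ^ n" using y by (intro power_mono) auto
      hence "inverse (((1 - \<theta> * y) ^ 2) ^ n) \<le> inverse ((1 - y) ^ n)"
        using y by (intro le_imp_inverse_le) auto
      hence kh: "k t ^ 2 \<le> h t"
        by (simp add: k_def h_def y_def power_inverse power_mult[symmetric] mult.commute)
      have "2 * D * k t \<le> k t ^ 2 + D ^ 2" using sum_squares_bound[of "k t" D] by (simp add: mult_ac)
      with kh D show "k t \<le> h t / (2 * D) + D / 2" by (simp add: field_simps power2_eq_square)
    qed
    also have "E n (\<lambda>t. h t / (2 * D) + D / 2) = E n h / (2 * D) + D / 2"
      using integrable_nu[OF n bh] integrable_nu[OF n bounded_unitI[of "\<lambda>_. D / 2" "\<bar>D / 2\<bar>"]] E_const[OF n, of "D / 2"]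
      by (subst Bochner_Integration.integral_add) auto
    finally have "E n h \<le> D * (E n h / (2 * D) + D / 2)" using D by simp
    thus "E n (\<lambda>t. inverse ((1 - \<bar>t - xw\<bar> / \<rho>) ^ n)) \<le> D ^ 2"
      unfolding h_def[symmetric] using D by (simp add: field_simps power2_eq_square)
  qed (use D in simp)
qed

section \<open>Exponential decay of the mean distance to the centre\<close>

lemma bounded_unit_dist: "bounded_unit (\<lambda>t. \<bar>t - xw\<bar>)"
  by (rule bounded_unitI[of _ R]) (auto simp: dist_xw_le)

text \<open>In the stationarity identity for \<open>|t - xw|\<close> the word \<open>s\<close>
  contributes at most half of \<open>\<theta> ^ n * m\<close>, which is absorbed. Every other gap
  word ends with \<open>s\<close> and so is longer by at least one digit, which makes its weight
  smaller than \<open>\<theta> ^ n\<close> by a factor of order \<open>\<beta> ^ n\<close>.\<close>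

lemma mean_dist_bound:
  assumes n: "n \<ge> 1"
  shows "\<beta> * \<theta> * E n (\<lambda>t. \<bar>t - xw\<bar>) \<le> 2 * \<Lambda> 1 * \<beta> ^ n"
proof -
  define m where "m = E n (\<lambda>t. \<bar>t - xw\<bar>)"
  \<comment> \<open>For \<open>g\<close> other than \<open>s\<close>, \<open>n - 1\<close> of the
    \<open>n\<close> factors \<open>\<beta> ^ length g\<close> are bounded by this constant through
    \<open>length g \<ge> length s + 1\<close>; the last one is kept for summation.\<close>
  define c where "c = \<beta> ^ ((n - 1) * (length s + 1))"
  have single_summable: "(\<lambda>g. if g = s then \<theta> ^ n * (\<theta> * m) else 0) summable_on G"
    by (rule iffD1[OF summable_on_cong_neutral[where S = "{s}" and T = G and f = "\<lambda>_. \<theta> ^ n * (\<theta> * m)"]])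
       (use s_gap in auto)
  have m: "m \<ge> 0" unfolding m_def by (intro E_nonneg) auto
  have "\<theta> ^ n * m \<le> \<Lambda> n * m"
    using \<Lambda>_lower[OF n] m by (intro mult_right_mono) (simp_all add: \<theta>_def power_mult mult.commute[of n])
  also have "\<dots> = (\<Sum>\<^sub>\<infinity>g\<in>G. \<beta> ^ (n * length g) * E n (\<lambda>t. \<bar>\<phi> g t - xw\<bar>))"
    unfolding m_def by (rule stationary[OF n bounded_unit_dist])
  also have "\<dots> \<le> (\<Sum>\<^sub>\<infinity>g\<in>G. (if g = s then \<theta> ^ n * (\<theta> * m) else 0) + c * \<beta> ^ (1 * length g))"
  proof (rule infsum_mono)
    fix g assume g: "g \<in> G"
    show "\<beta> ^ (n * length g) * E n (\<lambda>t. \<bar>\<phi> g t - xw\<bar>)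
        \<le> (if g = s then \<theta> ^ n * (\<theta> * m) else 0) + c * \<beta> ^ (1 * length g)"
    proof (cases "g = s")
      case True
      have "(\<lambda>t. \<bar>\<phi> s t - xw\<bar>) = (\<lambda>t. \<theta> * \<bar>t - xw\<bar>)"
        using \<phi>_diff[of s _ xw] \<theta>_bounds by (simp add: \<phi>_s_xw \<theta>_def abs_mult)
      thus ?thesis using True \<beta>_bounds by (simp add: m_def c_def \<theta>_def power_mult mult.commute[of n])
    next
      case False
      obtain h where h: "g = h @ s" using gap_decomp[OF g] by blast
      hence "length g \<ge> length s + 1" using False by (cases h) auto
      hence "(n - 1) * (length s + 1) \<le> (n - 1) * length g" by (rule mult_left_mono) simp
      moreover have "n * length g = (n - 1) * length g + length g" using n by (cases n) auto
      ultimately have "(n - 1) * (length s + 1) + length g \<le> n * length g" by linarith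
      hence "\<beta> ^ (n * length g) \<le> \<beta> ^ ((n - 1) * (length s + 1) + length g)"
        using \<beta>_bounds by (intro power_decreasing) auto
      hence "\<beta> ^ (n * length g) \<le> c * \<beta> ^ length g" by (simp only: c_def power_add)
      moreover have "E n (\<lambda>t. \<bar>\<phi> g t - xw\<bar>) \<le> 1"
        using E_\<phi>_bound[OF n bounded_unit_dist, of 1 g] dist_xw_le R_bounds g by fastforce
      moreover have "0 \<le> E n (\<lambda>t. \<bar>\<phi> g t - xw\<bar>)" by (intro E_nonneg) auto
      ultimately have "\<beta> ^ (n * length g) * E n (\<lambda>t. \<bar>\<phi> g t - xw\<bar>) \<le> (c * \<beta> ^ length g) * 1"
        using \<beta>_bounds by (intro mult_mono) (auto simp: c_def)
      thus ?thesis using False by simp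
    qed
  next
    show "(\<lambda>g. \<beta> ^ (n * length g) * E n (\<lambda>t. \<bar>\<phi> g t - xw\<bar>)) summable_on G"
      by (rule stationary_summable[OF n bounded_unit_dist])
    show "(\<lambda>g. (if g = s then \<theta> ^ n * (\<theta> * m) else 0) + c * \<beta> ^ (1 * length g)) summable_on G"
    proof (rule summable_on_add)
      show "(\<lambda>g. if g = s then \<theta> ^ n * (\<theta> * m) else 0) summable_on G"
        by (rule single_summable)
    qed (intro summable_on_cmult_right weight_summable order_refl)
  qed
  also have "\<dots> = \<theta> ^ n * (\<theta> * m) + c * \<Lambda> 1"
  proof (subst infsum_add)
    show "(\<lambda>g. if g = s then \<theta> ^ n * (\<theta> * m) else 0) summable_on G"
      by (rule single_summable)
    show "(\<lambda>g. c * \<beta> ^ (1 * length g)) summable_on G"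
      by (intro summable_on_cmult_right weight_summable order_refl)
    have "(\<Sum>\<^sub>\<infinity>g\<in>G. if g = s then \<theta> ^ n * (\<theta> * m) else 0) = (\<Sum>\<^sub>\<infinity>g\<in>{s}. \<theta> ^ n * (\<theta> * m))"
      by (rule infsum_cong_neutral) (use s_gap in auto)
    thus "(\<Sum>\<^sub>\<infinity>g\<in>G. if g = s then \<theta> ^ n * (\<theta> * m) else 0) + (\<Sum>\<^sub>\<infinity>g\<in>G. c * \<beta> ^ (1 * length g))
        = \<theta> ^ n * (\<theta> * m) + c * \<Lambda> 1"
      by (simp add: \<Lambda>_def infsum_cmult_right')
  qed
  finally have "\<theta> ^ n * m \<le> \<theta> ^ n * (\<theta> * m) + c * \<Lambda> 1" .
  moreover have "\<theta> ^ n * (\<theta> * m) \<le> \<theta> ^ n * (1 / 2 * m)"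
    using \<theta>_bounds m by (intro mult_left_mono mult_right_mono) auto
  ultimately have "\<theta> ^ n * m \<le> 2 * (c * \<Lambda> 1)" by linarith
  hence "\<theta> ^ n * m \<le> 2 * \<Lambda> 1 * c" by (simp only: mult_ac)
  \<comment> \<open>The factor \<open>\<beta> * \<theta>\<close>, equal to
    \<open>\<beta> ^ (length s + 1)\<close>, restores the exponent \<open>n\<close> in
    \<open>c\<close>.\<close>
  hence "\<beta> * \<theta> * (\<theta> ^ n * m) \<le> \<beta> * \<theta> * (2 * \<Lambda> 1 * c)" using \<beta>_bounds \<theta>_bounds by (intro mult_left_mono) auto
  also have "\<beta> * \<theta> * (2 * \<Lambda> 1 * c) = 2 * \<Lambda> 1 * (c * \<beta> ^ (length s + 1))" by (simp add: \<theta>_def)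
  also have "c * \<beta> ^ (length s + 1) = \<beta> ^ (n * (length s + 1))"
    unfolding c_def power_add[symmetric] using n by (cases n) (auto simp: algebra_simps)
  also have "\<dots> = \<theta> ^ n * \<beta> ^ n"
    by (simp add: \<theta>_def power_mult[symmetric] power_add[symmetric] algebra_simps)
  finally have "\<theta> ^ n * (\<beta> * \<theta> * m) \<le> \<theta> ^ n * (2 * \<Lambda> 1 * \<beta> ^ n)" by (simp add: mult_ac)
  thus ?thesis using \<theta>_bounds by (simp add: m_def)
qed

end

subsection \<open>The functionals and the eigenpolynomials\<close>

lemma has_sum_finite_sum:
  fixes f :: "'i \<Rightarrow> 'a \<Rightarrow> 'b :: topological_comm_monoid_add"
  assumes "finite I" and "\<And>i. i \<in> I \<Longrightarrow> (f i has_sum a i) A"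
  shows "((\<lambda>x. \<Sum>i\<in>I. f i x) has_sum (\<Sum>i\<in>I. a i)) A"
  using assms by (induction I rule: finite_induct) (auto intro: has_sum_add)

text \<open>This is the factor in the \<open>m\<close>-th derivative of an \<open>n\<close>-th
  power. For \<open>m > n\<close> the truncated subtraction gives a Pochhammer symbol starting at 0,
  so both sides vanish.\<close>

lemma pochhammer_choose:
  "pochhammer (of_nat (Suc n - m)) m = (fact m * of_nat (n choose m) :: 'a :: field_char_0)"
proof (cases "m \<le> n")
  case True
  have "(of_nat n :: 'a) gchoose m = pochhammer (of_nat (Suc n - m)) m / fact m"
    using True unfolding gbinomial_pochhammer' by (simp add: of_nat_diff Suc_diff_le algebra_simps)
  thus ?thesis by (simp add: binomial_gbinomial field_simps)
next
  case False
  hence "Suc n - m = 0" "m > 0" by auto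
  thus ?thesis using False by (simp add: pochhammer_0_left)
qed

section \<open>The functionals \<open>ell\<close> and their Cauchy bounds\<close>

context gap_setting
begin

definition cxw :: complex where "cxw = of_real xw"

definition ell :: "nat \<Rightarrow> (complex \<Rightarrow> complex) \<Rightarrow> complex" where
  "ell m f = (LINT t:{0..1}|nu b w (m + 1). (deriv ^^ m) f (of_real t)) / fact m"

lemma dist_cxw: "dist cxw (of_real t) = \<bar>t - xw\<bar>"
  unfolding cxw_def by (simp add: dist_norm norm_of_real flip: of_real_diff)

lemma unit_in_cball: "R < \<rho> \<Longrightarrow> t \<in> {0..1} \<Longrightarrow> complex_of_real t \<in> cball cxw \<rho>"
  using dist_xw_le[of t] by (simp add: dist_cxw)

text \<open>Cauchy's inequality on the disk about \<open>t\<close> of radius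
  \<open>\<rho> - |t - xw|\<close>, which lies in the large disk about the centre. The exponent is
  raised from \<open>m\<close> to \<open>m + 1\<close> to match the index of the law
  \<open>nu\<close> in \<open>ell m\<close>.\<close>

lemma higher_deriv_unit_bound:
  assumes \<rho>: "R < \<rho>" and S: "open S" "cball cxw \<rho> \<subseteq> S" and f: "f holomorphic_on S"
    and A: "\<And>z. z \<in> cball cxw \<rho> \<Longrightarrow> norm (f z) \<le> A" and t: "t \<in> {0..1}"
  shows "norm ((deriv ^^ m) f (of_real t))
           \<le> fact m * A / \<rho> ^ m * inverse ((1 - \<bar>t - xw\<bar> / \<rho>) ^ (m + 1))"
proof -
  define \<sigma> where "\<sigma> = \<rho> - \<bar>t - xw\<bar>"
  have \<rho>0: "\<rho> > 0" using \<rho> R_bounds by linarith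
  have \<sigma>: "\<sigma> > 0" using dist_xw_le[OF t] \<rho> by (simp add: \<sigma>_def)
  have sub: "cball (of_real t) \<sigma> \<subseteq> cball cxw \<rho>"
    by (rule cball_subset_cball_iff[THEN iffD2]) (use \<sigma> in \<open>auto simp: \<sigma>_def dist_cxw dist_commute[of "of_real t"]\<close>)
  have A0: "A \<ge> 0" using A[of cxw] order_trans[OF norm_ge_zero[of "f cxw"]] \<rho>0 by auto
  have "norm ((deriv ^^ m) f (of_real t)) \<le> fact m * A / \<sigma> ^ m"
  proof (rule Cauchy_inequality[OF _ _ \<sigma>])
    show "f holomorphic_on ball (of_real t) \<sigma>"
      using sub S ball_subset_cball by (intro holomorphic_on_subset[OF f]) blast
    show "continuous_on (cball (of_real t) \<sigma>) f"
      using sub S by (intro holomorphic_on_imp_continuous_on holomorphic_on_subset[OF f]) blast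
    fix z :: complex assume "norm (of_real t - z) = \<sigma>"
    hence "z \<in> cball (of_real t) \<sigma>" by (simp add: dist_norm)
    thus "norm (f z) \<le> A" using sub A by blast
  qed
  also have "\<dots> = fact m * A / \<rho> ^ m * inverse ((1 - \<bar>t - xw\<bar> / \<rho>) ^ m)"
  proof -
    have "\<sigma> = \<rho> * (1 - \<bar>t - xw\<bar> / \<rho>)" using \<rho>0 by (simp add: \<sigma>_def field_simps)
    thus ?thesis by (simp add: power_mult_distrib divide_inverse)
  qed
  also have "\<dots> \<le> fact m * A / \<rho> ^ m * inverse ((1 - \<bar>t - xw\<bar> / \<rho>) ^ (m + 1))"
  proof (intro mult_left_mono le_imp_inverse_le)
    have "0 < 1 - \<bar>t - xw\<bar> / \<rho>" "1 - \<bar>t - xw\<bar> / \<rho> \<le> 1" using \<sigma> \<rho>0 by (auto simp: \<sigma>_def)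
    thus "(1 - \<bar>t - xw\<bar> / \<rho>) ^ (m + 1) \<le> (1 - \<bar>t - xw\<bar> / \<rho>) ^ m"
         "0 < (1 - \<bar>t - xw\<bar> / \<rho>) ^ (m + 1)"
      by (auto intro: mult_left_le_one_le)
  qed (use A0 \<rho>0 in auto)
  finally show ?thesis .
qed

lemma cball_bounded:
  fixes f :: "complex \<Rightarrow> complex"
  assumes "cball cxw \<rho> \<subseteq> S" "f holomorphic_on S"
  obtains A where "\<And>z. z \<in> cball cxw \<rho> \<Longrightarrow> norm (f z) \<le> A"
proof -
  have "compact (f ` cball cxw \<rho>)"
    by (rule compact_continuous_image[OF holomorphic_on_imp_continuous_on[OF holomorphic_on_subset[OF assms(2,1)]] compact_cball])
  hence "bounded (f ` cball cxw \<rho>)" by (rule compact_imp_bounded)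
  then obtain A where "\<forall>x\<in>f ` cball cxw \<rho>. norm x \<le> A" by (auto simp: bounded_iff)
  thus ?thesis using that[of A] by blast
qed

lemma ell_integrable:
  assumes \<rho>: "R < \<rho>" and S: "open S" "cball cxw \<rho> \<subseteq> S" and f: "f holomorphic_on S"
  shows "set_integrable (nu b w (m + 1)) {0..1} (\<lambda>t. (deriv ^^ m) f (of_real t))"
proof -
  interpret prob_space "nu b w (m + 1)" by (rule prob_space_nu) simp
  obtain A where A: "\<And>z. z \<in> cball cxw \<rho> \<Longrightarrow> norm (f z) \<le> A" using cball_bounded[OF S(2) f] by blast
  have "bounded_unit (\<lambda>t. inverse ((1 - \<bar>t - xw\<bar> / \<rho>) ^ (m + 1)))"
    using bounded_unit_inverse_power[OF \<rho>, of 1 "m + 1"] by simp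
  then obtain C where C: "\<And>t. t \<in> {0..1} \<Longrightarrow> \<bar>inverse ((1 - \<bar>t - xw\<bar> / \<rho>) ^ (m + 1))\<bar> \<le> C"
    unfolding bounded_unit_def by blast
  have unit_S: "complex_of_real t \<in> S" if "t \<in> {0..1}" for t
    using unit_in_cball[OF \<rho> that] S(2) by blast
  have "continuous_on {0..1} (\<lambda>t. (deriv ^^ m) f (complex_of_real t))"
  proof (rule continuous_on_compose2[where g = "(deriv ^^ m) f" and t = S])
    show "continuous_on S ((deriv ^^ m) f)"
      by (intro holomorphic_on_imp_continuous_on holomorphic_higher_deriv f S)
  qed (use unit_S in \<open>auto intro!: continuous_intros\<close>)
  hence meas: "(\<lambda>t. indicator {0..1} t *\<^sub>R (deriv ^^ m) f (complex_of_real t)) \<in> borel_measurable (nu b w (m + 1))"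
    by (subst measurable_cong_sets[OF sets_nu refl]) (intro borel_measurable_continuous_on_indicator, auto)
  have "norm (indicator {0..1} t *\<^sub>R (deriv ^^ m) f (complex_of_real t)) \<le> fact m * \<bar>A\<bar> / \<rho> ^ m * C"
    if t: "t \<in> {0..1}" for t
  proof -
    have "norm ((deriv ^^ m) f (complex_of_real t))
        \<le> fact m * A / \<rho> ^ m * inverse ((1 - \<bar>t - xw\<bar> / \<rho>) ^ (m + 1))"
      by (rule higher_deriv_unit_bound[OF \<rho> S f A t])
    also have "\<dots> \<le> \<bar>fact m * A / \<rho> ^ m\<bar> * \<bar>inverse ((1 - \<bar>t - xw\<bar> / \<rho>) ^ (m + 1))\<bar>"
      by (metis abs_ge_self abs_mult)
    also have "\<dots> \<le> \<bar>fact m * A / \<rho> ^ m\<bar> * C" by (intro mult_left_mono C t) auto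
    finally show ?thesis using t \<rho> R_bounds by (simp add: abs_mult)
  qed
  thus ?thesis unfolding set_integrable_def
    by (intro integrable_const_bound[of _ "fact m * \<bar>A\<bar> / \<rho> ^ m * C"] meas AE_unit)
qed

text \<open>The pointwise Cauchy bound is integrated with \<open>inverse_power_bound\<close> at
  index \<open>m + 1\<close>. It is essential that \<open>D\<close> depends on \<open>\<rho>\<close>
  only.\<close>

lemma ell_bound:
  assumes \<rho>: "R < \<rho>"
  obtains D where "D > 0"
    "\<And>m S f A. open S \<Longrightarrow> cball cxw \<rho> \<subseteq> S \<Longrightarrow> f holomorphic_on S \<Longrightarrow>
        (\<And>z. z \<in> cball cxw \<rho> \<Longrightarrow> norm (f z) \<le> A) \<Longrightarrow> norm (ell m f) \<le> A * D / \<rho> ^ m"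
proof -
  obtain D where D: "D > 0" "\<And>n. n \<ge> 1 \<Longrightarrow> E n (\<lambda>t. inverse ((1 - \<bar>t - xw\<bar> / \<rho>) ^ n)) \<le> D"
    using inverse_power_bound[OF \<rho>] by blast
  have \<rho>0: "\<rho> > 0" using \<rho> R_bounds by linarith
  show ?thesis
  proof (rule that[OF D(1)])
    fix m S f A
    assume S: "open S" "cball cxw \<rho> \<subseteq> S" and f: "f holomorphic_on S"
      and A: "\<And>z. z \<in> cball cxw \<rho> \<Longrightarrow> norm (f z) \<le> A"
    have A0: "A \<ge> 0" using A[of cxw] order_trans[OF norm_ge_zero[of "f cxw"]] \<rho>0 by auto
    let ?M = "nu b w (m + 1)"
    let ?h = "\<lambda>t. indicator {0..1} t *\<^sub>R (deriv ^^ m) f (complex_of_real t)"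
    let ?k = "\<lambda>t. inverse ((1 - \<bar>t - xw\<bar> / \<rho>) ^ (m + 1))"
    have bk: "bounded_unit ?k" using bounded_unit_inverse_power[OF \<rho>, of 1 "m + 1"] by simp
    have int: "integrable ?M ?h" using ell_integrable[OF \<rho> S f] by (simp add: set_integrable_def)
    have "norm (integral\<^sup>L ?M ?h) \<le> integral\<^sup>L ?M (\<lambda>t. norm (?h t))" by (rule integral_norm_bound)
    also have "\<dots> \<le> integral\<^sup>L ?M (\<lambda>t. fact m * A / \<rho> ^ m * ?k t)"
    proof (rule integral_mono_AE)
      show "integrable ?M (\<lambda>t. norm (?h t))" using int by (rule integrable_norm)
      show "integrable ?M (\<lambda>t. fact m * A / \<rho> ^ m * ?k t)"
        by (intro integrable_mult_right integrable_nu bk) simp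
      show "AE t in ?M. norm (?h t) \<le> fact m * A / \<rho> ^ m * ?k t"
      proof (rule AE_unit)
        fix t :: real assume "t \<in> {0..1}"
        thus "norm (?h t) \<le> fact m * A / \<rho> ^ m * ?k t"
          using higher_deriv_unit_bound[OF \<rho> S f A, of t m] by (simp del: power_Suc)
      qed
    qed
    also have "\<dots> = fact m * A / \<rho> ^ m * E (m + 1) ?k" by simp
    also have "\<dots> \<le> fact m * A / \<rho> ^ m * D"
      using A0 \<rho>0 D(2)[of "m + 1"] by (intro mult_left_mono) auto
    finally have "norm (integral\<^sup>L ?M ?h) \<le> fact m * (A * D / \<rho> ^ m)" by simp
    thus "norm (ell m f) \<le> A * D / \<rho> ^ m"
      unfolding ell_def set_lebesgue_integral_def by (simp add: norm_divide divide_le_eq mult.commute)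
  qed
qed

lemma ell_add:
  assumes \<rho>: "R < \<rho>" and S: "open S" "cball cxw \<rho> \<subseteq> S" and f: "f holomorphic_on S" and g: "g holomorphic_on S"
  shows "ell m (\<lambda>z. f z + g z) = ell m f + ell m g"
proof -
  have "(LINT t:{0..1}|nu b w (m + 1). (deriv ^^ m) (\<lambda>z. f z + g z) (of_real t))
      = (LINT t:{0..1}|nu b w (m + 1). (deriv ^^ m) f (of_real t) + (deriv ^^ m) g (of_real t))"
    by (intro set_lebesgue_integral_cong)
       (use unit_in_cball[OF \<rho>] S in \<open>auto intro!: higher_deriv_add[OF f g S(1)] simp: subset_iff simp del: mem_cball\<close>)
  also have "\<dots> = (LINT t:{0..1}|nu b w (m + 1). (deriv ^^ m) f (of_real t))
                + (LINT t:{0..1}|nu b w (m + 1). (deriv ^^ m) g (of_real t))"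
    by (intro set_integral_add ell_integrable[OF \<rho> S] f g)
  finally show ?thesis by (simp add: ell_def add_divide_distrib)
qed

lemma ell_cmult:
  assumes \<rho>: "R < \<rho>" and S: "open S" "cball cxw \<rho> \<subseteq> S" and f: "f holomorphic_on S"
  shows "ell m (\<lambda>z. a * f z) = a * ell m f"
proof -
  have "(LINT t:{0..1}|nu b w (m + 1). (deriv ^^ m) (\<lambda>z. a * f z) (of_real t))
      = (LINT t:{0..1}|nu b w (m + 1). a * (deriv ^^ m) f (of_real t))"
    by (intro set_lebesgue_integral_cong)
       (use unit_in_cball[OF \<rho>] S in \<open>auto intro!: higher_deriv_cmult[OF f _ S(1)] simp: subset_iff simp del: mem_cball\<close>)
  thus ?thesis by (simp add: ell_def)
qed

text \<open>The value of \<open>ell m\<close> on the \<open>n\<close>-th power of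
  \<open>z - cxw\<close>, as \<open>ell_power\<close> shows; it is written with real moments so that
  it is visibly real.\<close>

definition c :: "nat \<Rightarrow> nat \<Rightarrow> real" where
  "c n m = real (n choose m) * E (m + 1) (\<lambda>t. (t - xw) ^ (n - m))"

lemma bounded_unit_power: "bounded_unit (\<lambda>t. (t - xw) ^ k)"
  by (rule bounded_unitI[of _ "R ^ k"]) (auto simp: power_abs intro!: power_mono dist_xw_le)

lemma c_diag [simp]: "c n n = 1"
  using E_const[of "n + 1" 1] by (simp add: c_def)

lemma c_zero: "m > n \<Longrightarrow> c n m = 0"
  by (simp add: c_def)

lemma ell_power: "ell m (\<lambda>z. (z - cxw) ^ n) = of_real (c n m)"
proof -
  have "(LINT t:{0..1}|nu b w (m + 1). (deriv ^^ m) (\<lambda>z. (z - cxw) ^ n) (of_real t))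
      = (LINT t|nu b w (m + 1). complex_of_real (fact m * real (n choose m) * (indicator {0..1} t * (t - xw) ^ (n - m))))"
    unfolding set_lebesgue_integral_def higher_deriv_power pochhammer_choose cxw_def
    by (intro Bochner_Integration.integral_cong refl) (simp add: scaleR_conv_of_real)
  also have "\<dots> = of_real (fact m * real (n choose m) * E (m + 1) (\<lambda>t. indicator {0..1} t * (t - xw) ^ (n - m)))"
    by (subst integral_complex_of_real) simp
  also have "E (m + 1) (\<lambda>t. indicator {0..1} t * (t - xw) ^ (n - m)) = E (m + 1) (\<lambda>t. (t - xw) ^ (n - m))"
    by (intro integral_cong_AE AE_unit) auto
  finally show ?thesis by (simp add: ell_def c_def)
qed

lemma ell_polynomial:
  "ell m (\<lambda>z. \<Sum>n<N. a n * (z - cxw) ^ n) = (\<Sum>n<N. a n * of_real (c n m))"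
proof (induction N)
  case 0
  show ?case by (simp add: ell_def)
next
  case (Suc N)
  have "ell m (\<lambda>z. (\<Sum>n<N. a n * (z - cxw) ^ n) + a N * (z - cxw) ^ N)
      = ell m (\<lambda>z. \<Sum>n<N. a n * (z - cxw) ^ n) + ell m (\<lambda>z. a N * (z - cxw) ^ N)"
    \<comment> \<open>The functions are entire, so any radius above \<open>R\<close> serves.\<close>
    by (rule ell_add[of "R + 1" UNIV]) (auto intro!: holomorphic_intros)
  also have "ell m (\<lambda>z. a N * (z - cxw) ^ N) = a N * ell m (\<lambda>z. (z - cxw) ^ N)"
    by (rule ell_cmult[of "R + 1" UNIV]) (auto intro!: holomorphic_intros)
  finally show ?case by (simp add: Suc ell_power)
qed

text \<open>\<open>ell_bound\<close> for a power of \<open>z - cxw\<close>, whose modulus on the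
  disk is at most \<open>\<rho> ^ n\<close>.\<close>

lemma c_bound:
  assumes "R < \<rho>"
  obtains D where "D > 0" "\<And>n m. \<bar>c n m\<bar> \<le> D * \<rho> ^ n / \<rho> ^ m"
proof -
  obtain D where D: "D > 0"
    "\<And>m S f A. open S \<Longrightarrow> cball cxw \<rho> \<subseteq> S \<Longrightarrow> f holomorphic_on S \<Longrightarrow>
        (\<And>z. z \<in> cball cxw \<rho> \<Longrightarrow> norm (f z) \<le> A) \<Longrightarrow> norm (ell m f) \<le> A * D / \<rho> ^ m"
    using ell_bound[OF assms] by blast
  show ?thesis
  proof (rule that[OF D(1)])
    fix n m
    have "norm (ell m (\<lambda>z. (z - cxw) ^ n)) \<le> \<rho> ^ n * D / \<rho> ^ m"
      by (rule D(2)[of UNIV])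
         (auto intro!: holomorphic_intros power_mono simp: norm_power dist_norm norm_minus_commute)
    thus "\<bar>c n m\<bar> \<le> D * \<rho> ^ n / \<rho> ^ m" by (simp add: ell_power mult.commute)
  qed
qed

section \<open>The operator in the basis of powers of \<open>x - xw\<close>, and its
  eigenpolynomials\<close>

definition \<delta> where "\<delta> g = \<phi> g xw - xw"

text \<open>The entries of the matrix of \<open>K_op\<close>: the image of the \<open>n\<close>-th
  power of \<open>x - xw\<close> has \<open>\<kappa> n k\<close> as coefficient of the
  \<open>k\<close>-th power, as shown in \<open>K_sums_power\<close>.\<close>

definition \<kappa> where
  "\<kappa> n k = real (n choose k) * (\<Sum>\<^sub>\<infinity>g\<in>G. \<beta> ^ ((k + 1) * length g) * \<delta> g ^ (n - k))"

lemma \<delta>_le: "g \<in> G \<Longrightarrow> \<bar>\<delta> g\<bar> \<le> 1"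
  using dist_xw_le[OF \<phi>_bounds[OF gap_lists], of g xw] xw_bounds R_bounds by (simp add: \<delta>_def)

lemma \<kappa>_has_sum:
  "((\<lambda>g. \<beta> ^ ((k + 1) * length g) * \<delta> g ^ j) has_sum
     (\<Sum>\<^sub>\<infinity>g\<in>G. \<beta> ^ ((k + 1) * length g) * \<delta> g ^ j)) G"
proof (rule has_sum_infsum, rule abs_summable_summable, rule summable_on_comparison_test)
  show "(\<lambda>g. \<beta> ^ ((k + 1) * length g)) summable_on G" by (rule weight_summable) simp
  fix g assume "g \<in> G"
  hence "\<bar>\<delta> g\<bar> ^ j \<le> 1" by (intro power_le_one \<delta>_le) auto
  thus "norm (\<beta> ^ ((k + 1) * length g) * \<delta> g ^ j) \<le> \<beta> ^ ((k + 1) * length g)"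
    using \<beta>_bounds mult_left_mono[of "\<bar>\<delta> g\<bar> ^ j" 1 "\<beta> ^ ((k + 1) * length g)"] by (simp add: abs_mult power_abs)
qed simp

lemma \<phi>_centered: "\<phi> g t - xw = \<delta> g + \<beta> ^ length g * (t - xw)"
  using \<phi>_diff[of g t xw] by (simp add: \<delta>_def)

lemma E_sum:
  assumes "n \<ge> 1" "\<And>i. i \<in> I \<Longrightarrow> bounded_unit (h i)"
  shows "E n (\<lambda>t. \<Sum>i\<in>I. a i * h i t) = (\<Sum>i\<in>I. a i * E n (h i))"
  by (subst Bochner_Integration.integral_sum) (auto intro!: integrable_mult_right integrable_nu assms)

text \<open>In matrix form, \<open>ell m\<close> is a left eigenvector of the operator for the
  eigenvalue \<open>\<Lambda> (m + 1)\<close>. It is stationarity for the power \<open>n - m\<close>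
  of \<open>t - xw\<close>, with the images under \<open>\<phi> g\<close> expanded by the binomial
  theorem.\<close>

lemma \<kappa>_c: "(\<Sum>k\<le>n. \<kappa> n k * c k m) = \<Lambda> (m + 1) * c n m"
proof (cases "m \<le> n")
  case True
  define j where "j = n - m"
  define M where "M i = E (m + 1) (\<lambda>t. (t - xw) ^ i)" for i
  define S where "S k i = (\<Sum>\<^sub>\<infinity>g\<in>G. \<beta> ^ ((k + 1) * length g) * \<delta> g ^ i)" for k i
  have "\<Lambda> (m + 1) * M j = (\<Sum>\<^sub>\<infinity>g\<in>G. \<beta> ^ ((m + 1) * length g) * E (m + 1) (\<lambda>t. (\<phi> g t - xw) ^ j))"
    unfolding M_def by (rule stationary) (auto intro: bounded_unit_power)
  also have "\<dots> = (\<Sum>\<^sub>\<infinity>g\<in>G. \<Sum>i\<le>j. real (j choose i) * M i * (\<beta> ^ ((m + i + 1) * length g) * \<delta> g ^ (j - i)))"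
  proof (intro infsum_cong)
    fix g
    have "E (m + 1) (\<lambda>t. (\<phi> g t - xw) ^ j)
        = E (m + 1) (\<lambda>t. \<Sum>i\<le>j. (real (j choose i) * \<beta> ^ (i * length g) * \<delta> g ^ (j - i)) * (t - xw) ^ i)"
      unfolding \<phi>_centered add.commute[of "\<delta> g"]
      by (subst binomial_ring) (simp add: power_mult_distrib mult_ac flip: power_mult)
    also have "\<dots> = (\<Sum>i\<le>j. (real (j choose i) * \<beta> ^ (i * length g) * \<delta> g ^ (j - i)) * M i)"
      unfolding M_def by (rule E_sum) (auto intro: bounded_unit_power)
    finally have "E (m + 1) (\<lambda>t. (\<phi> g t - xw) ^ j)
        = (\<Sum>i\<le>j. (real (j choose i) * \<beta> ^ (i * length g) * \<delta> g ^ (j - i)) * M i)" .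
    note E_eq = this
    show "\<beta> ^ ((m + 1) * length g) * E (m + 1) (\<lambda>t. (\<phi> g t - xw) ^ j)
        = (\<Sum>i\<le>j. real (j choose i) * M i * (\<beta> ^ ((m + i + 1) * length g) * \<delta> g ^ (j - i)))"
    proof -
      have "\<beta> ^ ((m + i + 1) * length g) = \<beta> ^ ((m + 1) * length g) * \<beta> ^ (i * length g)" for i
        by (simp add: algebra_simps flip: power_add)
      thus ?thesis unfolding E_eq by (simp only: sum_distrib_left mult_ac)
    qed
  qed
  also have "\<dots> = (\<Sum>i\<le>j. real (j choose i) * M i * S (m + i) (j - i))"
    unfolding S_def by (intro infsumI has_sum_finite_sum has_sum_cmult_right \<kappa>_has_sum) auto
  finally have main: "\<Lambda> (m + 1) * M j = (\<Sum>i\<le>j. real (j choose i) * M i * S (m + i) (j - i))" .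
  have "(\<Sum>k\<le>n. \<kappa> n k * c k m) = (\<Sum>k\<in>{m..n}. \<kappa> n k * c k m)"
    by (rule sum.mono_neutral_right) (auto simp: c_zero)
  also have "\<dots> = (\<Sum>i\<le>j. \<kappa> n (m + i) * c (m + i) m)"
    by (rule sum.reindex_bij_witness[of _ "\<lambda>i. m + i" "\<lambda>k. k - m"]) (use True in \<open>auto simp: j_def\<close>)
  also have "\<dots> = (\<Sum>i\<le>j. real (n choose m) * (real (j choose i) * M i * S (m + i) (j - i)))"
  proof (rule sum.cong[OF refl])
    fix i assume i: "i \<in> {..j}"
    \<comment> \<open>This identity separates the factor \<open>n choose m\<close>, common to all
      terms, from the binomial coefficients of the expansion.\<close>
    have "(n choose (m + i)) * ((m + i) choose m) = (n choose m) * ((n - m) choose (m + i - m))"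
      using i True by (intro choose_mult) (auto simp: j_def)
    hence "real (n choose (m + i)) * real ((m + i) choose m) = real (n choose m) * real (j choose i)"
      by (simp add: j_def flip: of_nat_mult)
    moreover have "n - (m + i) = j - i" by (simp add: j_def)
    ultimately show "\<kappa> n (m + i) * c (m + i) m = real (n choose m) * (real (j choose i) * M i * S (m + i) (j - i))"
      unfolding \<kappa>_def c_def M_def S_def by simp
  qed
  also have "\<dots> = real (n choose m) * (\<Lambda> (m + 1) * M j)" by (simp only: main sum_distrib_left)
  finally show ?thesis by (simp add: c_def M_def j_def)
qed (auto simp: c_zero)

text \<open>Convergence is recorded together with the value: \<open>infsum\<close> is 0 for a family
  that is not summable, so \<open>K_op\<close> alone would not be additive.\<close>

definition K_sums :: "(complex \<Rightarrow> complex) \<Rightarrow> (complex \<Rightarrow> complex) \<Rightarrow> bool" where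
  "K_sums f q \<longleftrightarrow> (\<forall>x. ((\<lambda>g. f (of_real (word_pt b g) + x / of_nat b ^ length g) / of_nat b ^ length g)
                        has_sum q x) G)"

lemma K_sums_K_op: "K_sums f q \<Longrightarrow> K_op b w f x = q x"
  unfolding K_sums_def K_op_def by (blast intro: infsumI)

lemma K_sums_sum:
  assumes "\<And>i. i \<in> I \<Longrightarrow> K_sums (f i) (q i)" "finite I"
  shows "K_sums (\<lambda>x. \<Sum>i\<in>I. a i * f i x) (\<lambda>x. \<Sum>i\<in>I. a i * q i x)"
  unfolding K_sums_def
proof
  fix x
  let ?y = "\<lambda>g. complex_of_real (word_pt b g) + x / of_nat b ^ length g"
  have "((\<lambda>g. \<Sum>i\<in>I. a i * (f i (?y g) / of_nat b ^ length g)) has_sum (\<Sum>i\<in>I. a i * q i x)) G"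
    using assms unfolding K_sums_def by (intro has_sum_finite_sum has_sum_cmult_right) auto
  thus "((\<lambda>g. (\<Sum>i\<in>I. a i * f i (?y g)) / of_nat b ^ length g) has_sum (\<Sum>i\<in>I. a i * q i x)) G"
    by (simp add: sum_divide_distrib)
qed

lemma K_sums_diff:
  assumes "K_sums f q" "K_sums f' q'"
  shows "K_sums (\<lambda>x. f x - f' x) (\<lambda>x. q x - q' x)"
  unfolding K_sums_def
proof
  fix x
  show "((\<lambda>g. (f (of_real (word_pt b g) + x / of_nat b ^ length g)
          - f' (of_real (word_pt b g) + x / of_nat b ^ length g)) / of_nat b ^ length g) has_sum (q x - q' x)) G"
    using has_sum_add[OF spec[OF assms(1)[unfolded K_sums_def]] has_sum_uminusI[OF spec[OF assms(2)[unfolded K_sums_def]]], of x x]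
    by (simp add: diff_divide_distrib)
qed

text \<open>Binomial expansion of \<open>\<delta> g + \<beta> ^ length g * (x - cxw)\<close>; the
  weight of the operator supplies one more factor \<open>\<beta> ^ length g\<close>, hence the
  exponent \<open>k + 1\<close> in \<open>\<kappa>\<close>.\<close>

lemma K_sums_power: "K_sums (\<lambda>x. (x - cxw) ^ n) (\<lambda>x. \<Sum>k\<le>n. of_real (\<kappa> n k) * (x - cxw) ^ k)"
  unfolding K_sums_def
proof
  fix x
  let ?y = "\<lambda>g. complex_of_real (word_pt b g) + x / of_nat b ^ length g"
  let ?s = "\<lambda>k g. complex_of_real (\<beta> ^ ((k + 1) * length g) * \<delta> g ^ (n - k))"
  have "((\<lambda>g. \<Sum>k\<le>n. (of_nat (n choose k) * (x - cxw) ^ k) * ?s k g) has_sum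
         (\<Sum>k\<le>n. (of_nat (n choose k) * (x - cxw) ^ k) *
              of_real (\<Sum>\<^sub>\<infinity>g\<in>G. \<beta> ^ ((k + 1) * length g) * \<delta> g ^ (n - k)))) G"
    by (intro has_sum_finite_sum has_sum_cmult_right has_sum_of_real \<kappa>_has_sum) auto
  also have "(\<lambda>g. \<Sum>k\<le>n. (of_nat (n choose k) * (x - cxw) ^ k) * ?s k g) = (\<lambda>g. (?y g - cxw) ^ n / of_nat b ^ length g)"
  proof
    fix g :: "nat list"
    have bb: "1 / of_nat b ^ length g = complex_of_real (\<beta> ^ length g)"
      by (simp add: \<beta>_def power_divide)
    have "?y g - cxw = of_real (\<beta> ^ length g) * (x - cxw) + of_real (\<delta> g)"
      using bb by (simp add: \<delta>_def \<phi>_def cxw_def divide_inverse algebra_simps)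
    hence "(?y g - cxw) ^ n / of_nat b ^ length g
        = (of_real (\<beta> ^ length g) * (x - cxw) + of_real (\<delta> g)) ^ n * of_real (\<beta> ^ length g)"
      using bb by (simp add: divide_inverse)
    also have "\<dots> = (\<Sum>k\<le>n. (of_nat (n choose k) * (x - cxw) ^ k) * ?s k g)"
    proof -
      have "complex_of_real (\<beta> ^ ((k + 1) * length g)) = of_real (\<beta> ^ length g) ^ k * of_real (\<beta> ^ length g)" for k
        by (simp add: power_add mult.commute flip: power_mult)
      thus ?thesis
        by (subst binomial_ring) (simp only: sum_distrib_left sum_distrib_right power_mult_distrib of_real_mult of_real_power mult_ac)
    qed
    finally show "(\<Sum>k\<le>n. (of_nat (n choose k) * (x - cxw) ^ k) * ?s k g) = (?y g - cxw) ^ n / of_nat b ^ length g" ..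
  qed
  also have "(\<Sum>k\<le>n. (of_nat (n choose k) * (x - cxw) ^ k) *
              of_real (\<Sum>\<^sub>\<infinity>g\<in>G. \<beta> ^ ((k + 1) * length g) * \<delta> g ^ (n - k)))
           = (\<Sum>k\<le>n. of_real (\<kappa> n k) * (x - cxw) ^ k)"
    by (simp add: \<kappa>_def mult_ac)
  finally show "((\<lambda>g. (?y g - cxw) ^ n / of_nat b ^ length g) has_sum
           (\<Sum>k\<le>n. of_real (\<kappa> n k) * (x - cxw) ^ k)) G" .
qed

text \<open>The recursive solution of the triangular system that expresses the powers of
  \<open>x - cxw\<close> through the matrix \<open>c\<close>, whose diagonal entries are 1.
  \<open>B_poly_eq\<close> identifies it with \<open>B_poly\<close>.\<close>

function Bp :: "nat \<Rightarrow> complex poly" where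
  "Bp m = [:- cxw, 1:] ^ m - (\<Sum>k<m. smult (of_real (c m k)) (Bp k))"
  by pat_completeness auto
termination by (relation "Wellfounded.measure id") auto

declare Bp.simps [simp del]

lemma poly_Bp: "poly (Bp m) x = (x - cxw) ^ m - (\<Sum>k<m. of_real (c m k) * poly (Bp k) x)"
  by (subst Bp.simps) (simp add: poly_sum)

lemma power_expansion: "(x - cxw) ^ m = (\<Sum>k\<le>m. of_real (c m k) * poly (Bp k) x)"
  by (simp add: poly_Bp[of m] flip: lessThan_Suc_atMost)

lemma Bp_monic: "degree (Bp m) = m \<and> lead_coeff (Bp m) = 1"
proof (induction m rule: less_induct)
  case (less m)
  have lin: "degree ([:- cxw, 1:] ^ m) = m" "coeff ([:- cxw, 1:] ^ m) m = 1"
    using lead_coeff_power[of "[:- cxw, 1:]" m] by (simp_all add: degree_linear_power)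
  show ?case
  proof (cases "m = 0")
    case False
    have "degree (\<Sum>k<m. smult (of_real (c m k)) (Bp k)) < m"
    proof (rule degree_sum_less)
      fix k assume "k \<in> {..<m}"
      thus "degree (smult (of_real (c m k)) (Bp k)) < m"
        using less[of k] degree_smult_le[of "of_real (c m k)" "Bp k"] by simp
    qed (use False in simp)
    hence "degree (Bp m) = m" "coeff (\<Sum>k<m. smult (of_real (c m k)) (Bp k)) m = 0"
      using lin degree_add_eq_left[of "- (\<Sum>k<m. smult (of_real (c m k)) (Bp k))" "[:- cxw, 1:] ^ m"]
      by (auto simp: Bp.simps[of m] coeff_eq_0)
    thus ?thesis using lin by (simp add: Bp.simps[of m])
  qed (simp add: Bp.simps[of 0])
qed

lemma degree_Bp [simp]: "degree (Bp m) = m" and coeff_Bp_self [simp]: "coeff (Bp m) m = 1"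
  using Bp_monic[of m] by auto

text \<open>
  By \<open>\<kappa>_c\<close>, the operator acts on \<open>(x - xw) ^ m = (\<Sum>k\<le>m. c m k * Bp k)\<close> as if every \<open>Bp k\<close> were an
  eigenvector; knowing this for \<open>k < m\<close> leaves it for \<open>k = m\<close>, since \<open>c m m = 1\<close>.
\<close>

lemma K_sums_Bp: "K_sums (poly (Bp m)) (\<lambda>x. of_real (\<Lambda> (m + 1)) * poly (Bp m) x)"
proof (induction m rule: less_induct)
  case (less m)
  have "K_sums (\<lambda>x. (x - cxw) ^ m - (\<Sum>k<m. of_real (c m k) * poly (Bp k) x))
     (\<lambda>x. (\<Sum>k\<le>m. of_real (\<kappa> m k) * (x - cxw) ^ k)
            - (\<Sum>k<m. of_real (c m k) * (of_real (\<Lambda> (k + 1)) * poly (Bp k) x)))"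
    by (intro K_sums_diff K_sums_power K_sums_sum less) auto
  moreover have "(\<Sum>k\<le>m. of_real (\<kappa> m k) * (x - cxw) ^ k)
      = (\<Sum>k<m. of_real (c m k) * (of_real (\<Lambda> (k + 1)) * poly (Bp k) x)) + of_real (\<Lambda> (m + 1)) * poly (Bp m) x" for x
  proof -
    have "(\<Sum>k\<le>m. of_real (\<kappa> m k) * (x - cxw) ^ k)
        = (\<Sum>k\<le>m. of_real (\<kappa> m k) * (\<Sum>i\<le>m. of_real (c k i) * poly (Bp i) x))"
    proof (intro sum.cong refl arg_cong2[where f = "(*)"])
      fix k assume "k \<in> {..m}"
      thus "(x - cxw) ^ k = (\<Sum>i\<le>m. of_real (c k i) * poly (Bp i) x)"
        unfolding power_expansion by (intro sum.mono_neutral_left) (auto simp: c_zero)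
    qed
    also have "\<dots> = (\<Sum>i\<le>m. of_real (\<Sum>k\<le>m. \<kappa> m k * c k i) * poly (Bp i) x)"
      unfolding sum_distrib_left of_real_sum sum_distrib_right by (subst sum.swap) (simp add: mult_ac)
    also have "\<dots> = (\<Sum>i\<le>m. of_real (c m i) * (of_real (\<Lambda> (i + 1)) * poly (Bp i) x))"
      by (simp add: \<kappa>_c mult_ac)
    finally show ?thesis by (simp flip: lessThan_Suc_atMost)
  qed
  moreover have "poly (Bp m) = (\<lambda>x. (x - cxw) ^ m - (\<Sum>k<m. of_real (c m k) * poly (Bp k) x))"
    by (rule ext) (rule poly_Bp)
  ultimately show ?case by (simp only: add_diff_cancel_left')
qed

text \<open>Subtracting a multiple of the monic \<open>Bp N\<close> removes the highest coefficient.
  The hypothesis is on coefficients, not on the degree, so that \<open>N = 0\<close> describes the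
  zero polynomial.\<close>

lemma Bp_basis:
  assumes "\<And>i. i \<ge> N \<Longrightarrow> coeff p i = 0"
  shows "\<exists>q. p = (\<Sum>i<N. smult (q i) (Bp i))"
  using assms
proof (induction N arbitrary: p)
  case 0
  thus ?case by (auto intro: poly_eqI)
next
  case (Suc N)
  define p' where "p' = p - smult (coeff p N) (Bp N)"
  have "coeff p' i = 0" if "i \<ge> N" for i
  proof (cases "i = N")
    case False
    thus ?thesis using that Suc.prems[of i] by (simp add: p'_def coeff_eq_0)
  qed (simp add: p'_def)
  then obtain q where q: "p' = (\<Sum>i<N. smult (q i) (Bp i))" using Suc.IH[of p'] by blast
  have "(\<Sum>i<Suc N. smult ((q(N := coeff p N)) i) (Bp i)) = p' + smult (coeff p N) (Bp N)"
    unfolding q by simp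
  also have "\<dots> = p" by (simp add: p'_def)
  finally show ?case by metis
qed

lemma Bp_independent:
  assumes "(\<Sum>i<N. smult (r i) (Bp i)) = 0" "i < N"
  shows "r i = 0"
  using assms
proof (induction N)
  case (Suc N)
  have "coeff (\<Sum>i<N. smult (r i) (Bp i)) N = 0"
    by (simp add: coeff_sum coeff_eq_0)
  hence "r N = 0" using arg_cong[OF Suc.prems(1), of "\<lambda>p. coeff p N"] by simp
  thus ?case using Suc by (cases "i = N") auto
qed simp

text \<open>For uniqueness, an eigenpolynomial is expanded in the \<open>Bp i\<close>, which are
  independent eigenvectors. As the eigenvalues are distinct, only the multiple of
  \<open>Bp m\<close> survives, and monicity makes its coefficient 1.\<close>

lemma B_poly_eq: "B_poly b w m = Bp m"
  unfolding B_poly_def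
proof (rule the_equality)
  show "degree (Bp m) = m \<and> lead_coeff (Bp m) = 1 \<and>
      (\<forall>x. K_op b w (poly (Bp m)) x = of_real (lam b w (real (m + 1))) * poly (Bp m) x)"
    unfolding lam_eq using K_sums_K_op[OF K_sums_Bp] by simp
next
  fix p assume "degree p = m \<and> lead_coeff p = 1 \<and>
      (\<forall>x. K_op b w (poly p) x = of_real (lam b w (real (m + 1))) * poly p x)"
  hence p: "degree p = m" "coeff p m = 1"
    and K: "\<And>x. K_op b w (poly p) x = of_real (\<Lambda> (m + 1)) * poly p x"
    unfolding lam_eq by auto
  obtain q where q: "p = (\<Sum>i<Suc m. smult (q i) (Bp i))"
    using Bp_basis[of "Suc m" p] p(1) by (auto simp: coeff_eq_0)
  have pp: "poly p = (\<lambda>x. \<Sum>i<Suc m. q i * poly (Bp i) x)"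
    by (intro ext) (simp only: q poly_sum poly_smult)
  have "K_sums (poly p) (\<lambda>x. \<Sum>i<Suc m. q i * (of_real (\<Lambda> (i + 1)) * poly (Bp i) x))"
    unfolding pp by (intro K_sums_sum K_sums_Bp) auto
  note K_sums_K_op[OF this]
  hence "of_real (\<Lambda> (m + 1)) * (\<Sum>i<Suc m. q i * poly (Bp i) x) - (\<Sum>i<Suc m. q i * (of_real (\<Lambda> (i + 1)) * poly (Bp i) x)) = 0" for x
    using K[of x] unfolding pp by (simp only: diff_self)
  hence "(\<Sum>i<Suc m. q i * (of_real (\<Lambda> (m + 1)) - of_real (\<Lambda> (i + 1))) * poly (Bp i) x) = 0" for x
    unfolding sum_distrib_left sum_subtractf[symmetric] by (simp add: algebra_simps)
  hence "poly (\<Sum>i<Suc m. smult (q i * (of_real (\<Lambda> (m + 1)) - of_real (\<Lambda> (i + 1)))) (Bp i)) = poly 0"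
    by (intro ext) (simp only: poly_sum poly_smult poly_0)
  hence "(\<Sum>i<Suc m. smult (q i * (of_real (\<Lambda> (m + 1)) - of_real (\<Lambda> (i + 1)))) (Bp i)) = 0"
    by (simp only: poly_eq_poly_eq_iff)
  hence "q i * (of_real (\<Lambda> (m + 1)) - of_real (\<Lambda> (i + 1))) = 0" if "i < Suc m" for i
    using Bp_independent[of "\<lambda>i. q i * (of_real (\<Lambda> (m + 1)) - of_real (\<Lambda> (i + 1)))" "Suc m" i] that by blast
  hence "q i = 0" if "i < m" for i
    using that \<Lambda>_inj[of "m + 1" "i + 1"] by (simp flip: of_real_diff) (metis less_Suc_eq nat_neq_iff)
  hence "p = smult (q m) (Bp m)" by (simp add: q)
  with p(2) show "p = Bp m" by simp
qed

end

subsection \<open>Growth of the eigenpolynomials and convergence\<close>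

context gap_setting
begin

text \<open>At a fixed distance from the diagonal the binomial coefficient grows polynomially in
  \<open>m\<close>, whereas the moment is at most the mean distance to \<open>xw\<close>, of order
  \<open>\<beta> ^ m\<close>.\<close>

lemma c_near_diagonal: "(\<lambda>m. c (m + Suc j) m) \<longlonglongrightarrow> 0"
proof (rule Lim_null_comparison)
  \<comment> \<open>The bound of \<open>mean_dist_bound\<close>, whose last factor
    \<open>\<beta>\<close> is there because the index of the law is \<open>m + 1\<close>.\<close>
  define C where "C = 2 * \<Lambda> 1 / (\<beta> * \<theta>) * \<beta>"
  show "\<forall>\<^sub>F m in sequentially. norm (c (m + Suc j) m) \<le> C * (real (m + Suc j) ^ Suc j * \<beta> ^ m)"
  proof (rule always_eventually, rule allI)
    fix m
    have "\<bar>E (m + 1) (\<lambda>t. (t - xw) ^ Suc j)\<bar> \<le> E (m + 1) (\<lambda>t. \<bar>(t - xw) ^ Suc j\<bar>)"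
      by (rule integral_abs_bound)
    also have "\<dots> \<le> E (m + 1) (\<lambda>t. \<bar>t - xw\<bar>)"
    proof (rule E_mono)
      show "bounded_unit (\<lambda>t. \<bar>(t - xw) ^ Suc j\<bar>)"
        using bounded_unit_power[of "Suc j"] unfolding bounded_unit_def by auto
      fix t :: real assume "t \<in> {0..1}"
      hence "\<bar>t - xw\<bar> \<le> 1" using dist_xw_le R_bounds(2) by fastforce
      hence "\<bar>t - xw\<bar> ^ Suc j \<le> \<bar>t - xw\<bar> ^ 1" by (intro power_decreasing) auto
      thus "\<bar>(t - xw) ^ Suc j\<bar> \<le> \<bar>t - xw\<bar>" by (simp only: power_abs power_one_right)
    qed (simp_all add: bounded_unit_dist)
    also have "\<dots> \<le> C * \<beta> ^ m"
      using mean_dist_bound[of "m + 1"] \<beta>_bounds \<theta>_bounds by (simp add: C_def field_simps)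
    finally have e: "\<bar>E (m + 1) (\<lambda>t. (t - xw) ^ Suc j)\<bar> \<le> C * \<beta> ^ m" .
    have "(m + Suc j) choose m = (m + Suc j) choose Suc j"
      using binomial_symmetric[of m "m + Suc j"] by simp
    also have "\<dots> \<le> (m + Suc j) ^ Suc j" by (rule binomial_le_pow) simp
    finally have "real ((m + Suc j) choose m) \<le> real (m + Suc j) ^ Suc j"
      unfolding of_nat_power[symmetric] by (rule of_nat_mono)
    hence "real ((m + Suc j) choose m) * \<bar>E (m + 1) (\<lambda>t. (t - xw) ^ Suc j)\<bar>
        \<le> real (m + Suc j) ^ Suc j * (C * \<beta> ^ m)"
      using e by (intro mult_mono) auto
    thus "norm (c (m + Suc j) m) \<le> C * (real (m + Suc j) ^ Suc j * \<beta> ^ m)"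
      by (simp add: c_def abs_mult mult_ac)
  qed
  have "(\<lambda>m. real (m + Suc j) ^ Suc j * \<beta> ^ m) \<longlonglongrightarrow> 0"
    using \<beta>_bounds(1,2) by real_asymp
  thus "(\<lambda>m. C * (real (m + Suc j) ^ Suc j * \<beta> ^ m)) \<longlonglongrightarrow> 0"
    by (rule tendsto_mult_right_zero)
qed

text \<open>Dominated convergence along the distance from the diagonal: each term tends to 0 by
  \<open>c_near_diagonal\<close>, and \<open>c_bound\<close> at a radius \<open>\<rho>'\<close>
  between \<open>R\<close> and \<open>\<rho>\<close> gives a geometric majorant of ratio
  \<open>\<rho>' / \<rho>\<close>.\<close>

lemma c_row_sum:
  assumes \<rho>: "R < \<rho>"
  shows "(\<lambda>m. \<Sum>k<m. \<bar>c m k\<bar> * \<rho> ^ k / \<rho> ^ m) \<longlonglongrightarrow> 0"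
proof -
  obtain \<rho>' where \<rho>': "R < \<rho>'" "\<rho>' < \<rho>" using \<rho> dense by blast
  have pos: "\<rho>' > 0" "\<rho> > 0" using \<rho>' R_bounds by linarith+
  obtain D where D: "D > 0" "\<And>n m. \<bar>c n m\<bar> \<le> D * \<rho>' ^ n / \<rho>' ^ m" using c_bound[OF \<rho>'(1)] by blast
  \<comment> \<open>The index \<open>j\<close> corresponds to the column
    \<open>k = m - Suc j\<close>; outside the row the term is 0.\<close>
  define a where "a j m = (if j < m then \<bar>c m (m - Suc j)\<bar> / \<rho> ^ Suc j else 0)" for j m
  define M where "M j = D * (\<rho>' / \<rho>) ^ Suc j" for j
  have "(\<lambda>m. suminf (\<lambda>j. a j m)) \<longlonglongrightarrow> suminf (\<lambda>j. 0)"
  proof (rule tannerys_theorem[where M = M, THEN conjunct2, THEN conjunct2])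
    fix j
    have "(\<lambda>m. \<bar>c (m + Suc j) m\<bar> / \<rho> ^ Suc j) \<longlonglongrightarrow> \<bar>0\<bar> / \<rho> ^ Suc j"
      using pos by (intro tendsto_divide tendsto_rabs c_near_diagonal tendsto_const) auto
    hence "(\<lambda>m. a j (m + Suc j)) \<longlonglongrightarrow> 0" by (simp add: a_def)
    thus "(\<lambda>m. a j m) \<longlonglongrightarrow> 0" by (rule LIMSEQ_offset)
  next
    have "norm (a j m) \<le> M j" for j m
    proof (cases "j < m")
      case True
      hence "m = (m - Suc j) + Suc j" by simp
      hence "\<rho>' ^ m / \<rho>' ^ (m - Suc j) = \<rho>' ^ Suc j"
        using pos by (metis nonzero_mult_div_cancel_left power_add power_not_zero less_numeral_extra(3))
      hence "\<bar>c m (m - Suc j)\<bar> \<le> D * \<rho>' ^ Suc j" using D(2)[of m "m - Suc j"] by (metis times_divide_eq_right)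
      thus ?thesis using True pos by (simp add: a_def M_def power_divide divide_right_mono)
    qed (use D pos in \<open>simp add: a_def M_def\<close>)
    thus "\<forall>\<^sub>F (j, m) in at_top \<times>\<^sub>F sequentially. norm (a j m) \<le> M j"
      by (intro always_eventually) auto
    show "summable M" unfolding M_def using pos \<rho>' by (intro summable_mult) (simp add: summable_geometric_iff)
  qed simp
  moreover have "suminf (\<lambda>j. a j m) = (\<Sum>k<m. \<bar>c m k\<bar> * \<rho> ^ k / \<rho> ^ m)" for m
  proof -
    have "suminf (\<lambda>j. a j m) = (\<Sum>j<m. a j m)" by (rule suminf_finite) (auto simp: a_def)
    also have "\<dots> = (\<Sum>j<m. \<bar>c m (m - Suc j)\<bar> * \<rho> ^ (m - Suc j) / \<rho> ^ m)"
    proof (rule sum.cong[OF refl])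
      fix j assume j: "j \<in> {..<m}"
      hence "\<rho> ^ m = \<rho> ^ (m - Suc j) * \<rho> ^ Suc j" by (simp flip: power_add power_Suc)
      thus "a j m = \<bar>c m (m - Suc j)\<bar> * \<rho> ^ (m - Suc j) / \<rho> ^ m"
        using j pos by (simp add: a_def)
    qed
    also have "\<dots> = (\<Sum>k<m. \<bar>c m k\<bar> * \<rho> ^ k / \<rho> ^ m)"
      by (rule sum.nat_diff_reindex)
    finally show ?thesis .
  qed
  ultimately show ?thesis by simp
qed

text \<open>If the earlier polynomials satisfy the bound with constant \<open>M\<close>, the
  recursion gives the constant \<open>1 + M * row m\<close> for the next. Once the row sum is below
  \<open>1/2\<close>, this is at most \<open>M\<close> as soon as \<open>M \<ge> 2\<close>, so the
  constant no longer grows.\<close>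

lemma Bp_bound:
  assumes \<rho>: "R < \<rho>"
  obtains C where "C > 0" "\<And>m x. x \<in> cball cxw \<rho> \<Longrightarrow> norm (poly (Bp m) x) \<le> C * \<rho> ^ m"
proof -
  have \<rho>0: "\<rho> > 0" using \<rho> R_bounds by linarith
  define row where "row m = (\<Sum>k<m. \<bar>c m k\<bar> * \<rho> ^ k / \<rho> ^ m)" for m
  have row0: "row m \<ge> 0" for m unfolding row_def using \<rho>0 by (intro sum_nonneg) auto
  have step: "norm (poly (Bp m) x) \<le> (1 + M * row m) * \<rho> ^ m"
    if x: "x \<in> cball cxw \<rho>" and M: "\<And>k. k < m \<Longrightarrow> norm (poly (Bp k) x) \<le> M * \<rho> ^ k" for m M x
  proof -
    have "norm (poly (Bp m) x) \<le> norm (x - cxw) ^ m + norm (\<Sum>k<m. of_real (c m k) * poly (Bp k) x)"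
      unfolding poly_Bp[of m] norm_power[symmetric] by (rule norm_triangle_ineq4)
    also have "norm (x - cxw) ^ m \<le> \<rho> ^ m"
      using x by (intro power_mono) (auto simp: dist_norm norm_minus_commute)
    also have "norm (\<Sum>k<m. of_real (c m k) * poly (Bp k) x) \<le> (\<Sum>k<m. \<bar>c m k\<bar> * (M * \<rho> ^ k))"
      by (intro sum_norm_le) (auto simp: norm_mult intro!: mult_left_mono M)
    also have "(\<Sum>k<m. \<bar>c m k\<bar> * (M * \<rho> ^ k)) = M * row m * \<rho> ^ m"
      using \<rho>0 by (simp add: row_def sum_distrib_left sum_distrib_right mult_ac)
    finally show ?thesis by (simp add: distrib_right)
  qed
  have bdd: "\<exists>M\<ge>2. \<forall>m<N. \<forall>x\<in>cball cxw \<rho>. norm (poly (Bp m) x) \<le> M * \<rho> ^ m" for N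
  proof (induction N)
    case (Suc N)
    then obtain M where M: "M \<ge> 2" "\<And>m x. m < N \<Longrightarrow> x \<in> cball cxw \<rho> \<Longrightarrow> norm (poly (Bp m) x) \<le> M * \<rho> ^ m"
      by blast
    show ?case
    proof (intro exI[of _ "max M (1 + M * row N)"] conjI allI impI ballI)
      fix m x assume m: "m < Suc N" and x: "x \<in> cball cxw \<rho>"
      show "norm (poly (Bp m) x) \<le> max M (1 + M * row N) * \<rho> ^ m"
      proof (cases "m = N")
        case True
        have "norm (poly (Bp N) x) \<le> (1 + M * row N) * \<rho> ^ N" using M(2) x by (intro step) auto
        also have "\<dots> \<le> max M (1 + M * row N) * \<rho> ^ N" using \<rho>0 by (intro mult_right_mono) auto
        finally show ?thesis using True by simp
      next
        case False
        hence "norm (poly (Bp m) x) \<le> M * \<rho> ^ m" using M(2) x m by simp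
        also have "\<dots> \<le> max M (1 + M * row N) * \<rho> ^ m" using \<rho>0 by (intro mult_right_mono) auto
        finally show ?thesis .
      qed
    qed (use M in simp)
  qed auto
  have "\<forall>\<^sub>F m in sequentially. row m < 1 / 2"
    using order_tendstoD(2)[OF c_row_sum[OF \<rho>], of "1 / 2"] by (simp add: row_def)
  then obtain N where N: "\<And>m. m \<ge> N \<Longrightarrow> row m < 1 / 2" by (auto simp: eventually_sequentially)
  obtain M where M: "M \<ge> 2"
    "\<And>m x. m < N \<Longrightarrow> x \<in> cball cxw \<rho> \<Longrightarrow> norm (poly (Bp m) x) \<le> M * \<rho> ^ m"
    using bdd[of N] by blast
  have "norm (poly (Bp m) x) \<le> M * \<rho> ^ m" if x: "x \<in> cball cxw \<rho>" for m x
  proof (induction m rule: less_induct)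
    case (less m)
    show ?case
    proof (cases "m < N")
      case False
      have "norm (poly (Bp m) x) \<le> (1 + M * row m) * \<rho> ^ m" by (intro step x less)
      also have "\<dots> \<le> M * \<rho> ^ m"
      proof (rule mult_right_mono)
        have "M * row m \<le> M * (1 / 2)" using N[of m] False M(1) by (intro mult_left_mono) auto
        thus "1 + M * row m \<le> M" using M(1) by linarith
      qed (use \<rho>0 in simp)
      finally show ?thesis .
    qed (use M x in auto)
  qed
  thus ?thesis using that[of M] M(1) by auto
qed

text \<open>For polynomials the expansion is finite and exact: each power is rewritten in the
  \<open>Bp m\<close>, and the collected coefficients are the functionals.\<close>

lemma polynomial_expansion:
  "(\<Sum>n<N. a n * (x - cxw) ^ n)
     = (\<Sum>m<N. ell m (\<lambda>z. \<Sum>n<N. a n * (z - cxw) ^ n) * poly (Bp m) x)"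
proof -
  have "(\<Sum>n<N. a n * (x - cxw) ^ n) = (\<Sum>n<N. \<Sum>m<N. a n * of_real (c n m) * poly (Bp m) x)"
  proof (rule sum.cong[OF refl])
    fix n assume n: "n \<in> {..<N}"
    have "(x - cxw) ^ n = (\<Sum>m<N. of_real (c n m) * poly (Bp m) x)"
      unfolding power_expansion using n by (intro sum.mono_neutral_left) (auto simp: c_zero)
    thus "a n * (x - cxw) ^ n = (\<Sum>m<N. a n * of_real (c n m) * poly (Bp m) x)"
      by (simp add: sum_distrib_left mult.assoc)
  qed
  also have "\<dots> = (\<Sum>m<N. (\<Sum>n<N. a n * of_real (c n m)) * poly (Bp m) x)"
    by (subst sum.swap) (simp add: sum_distrib_right)
  finally show ?thesis by (simp add: ell_polynomial)
qed

section \<open>The expansion of the Taylor sum\<close>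

context
  fixes F :: "complex fps" and r :: ereal and T :: "complex \<Rightarrow> complex"
  assumes r: "r = fps_conv_radius F" and R_r: "ereal R < r" and T: "T = (\<lambda>z. eval_fps F (z - cxw))"
begin

lemma cball_eball: "ereal \<rho> < r \<Longrightarrow> cball cxw \<rho> \<subseteq> eball cxw r"
proof
  fix z assume "ereal \<rho> < r" "z \<in> cball cxw \<rho>"
  thus "z \<in> eball cxw r" by (simp add: in_eball_iff) (metis ereal_less_eq(3) order_le_less_trans)
qed

lemma T_holomorphic: "T holomorphic_on eball cxw r"
proof -
  have "eval_fps F \<circ> (\<lambda>z. z - cxw) holomorphic_on eball cxw r"
  proof (rule holomorphic_on_compose)
    show "eval_fps F holomorphic_on (\<lambda>z. z - cxw) ` eball cxw r"
      by (rule holomorphic_on_eval_fps) (auto simp: in_eball_iff r dist_norm norm_minus_commute)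
  qed (intro holomorphic_intros)
  thus ?thesis by (simp add: T o_def)
qed

text \<open>The polynomials will be estimated at the radius \<open>\<rho>1\<close> and the
  functionals at the larger \<open>\<rho>2\<close>; their quotient is the geometric rate.\<close>

lemma radii:
  assumes "compact K" "K \<subseteq> eball cxw r"
  obtains \<rho>1 \<rho>2 where "R < \<rho>1" "\<rho>1 < \<rho>2" "ereal \<rho>2 < r" "K \<subseteq> cball cxw \<rho>1"
proof -
  obtain d where d: "ereal d < r" "\<And>x. x \<in> K \<Longrightarrow> dist cxw x \<le> d"
  proof (cases "K = {}")
    case False
    then obtain y where "y \<in> K" "\<And>x. x \<in> K \<Longrightarrow> dist cxw x \<le> dist cxw y"
      using distance_attains_sup[OF assms(1), of cxw] by blast
    thus ?thesis using assms(2) by (intro that[of "dist cxw y"]) (auto simp: in_eball_iff)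
  qed (use R_r that in blast)
  have "ereal (max R d) < r" using d(1) R_r by (simp add: max_def)
  then obtain \<rho>1 where "ereal (max R d) < ereal \<rho>1" "ereal \<rho>1 < r" using ereal_dense2 by blast
  moreover then obtain \<rho>2 where "ereal \<rho>1 < ereal \<rho>2" "ereal \<rho>2 < r" using ereal_dense2 by blast
  ultimately show ?thesis using d(2) by (intro that[of \<rho>1 \<rho>2]) force+
qed

lemma geometric_bound:
  assumes "compact K" "K \<subseteq> eball cxw r"
  shows "\<exists>C \<rho>. 0 \<le> \<rho> \<and> \<rho> < 1 \<and> (\<forall>m. \<forall>x\<in>K. norm (ell m T * poly (Bp m) x) \<le> C * \<rho> ^ m)"
proof -
  obtain \<rho>1 \<rho>2 where \<rho>: "R < \<rho>1" "\<rho>1 < \<rho>2" "ereal \<rho>2 < r" "K \<subseteq> cball cxw \<rho>1"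
    using radii[OF assms] by blast
  have R2: "R < \<rho>2" and pos: "0 < \<rho>1" "0 < \<rho>2" using \<rho> R_bounds by linarith+
  obtain C where C: "C > 0" "\<And>m x. x \<in> cball cxw \<rho>1 \<Longrightarrow> norm (poly (Bp m) x) \<le> C * \<rho>1 ^ m"
    using Bp_bound[OF \<rho>(1)] by blast
  obtain D where D: "\<And>m S f A. open S \<Longrightarrow> cball cxw \<rho>2 \<subseteq> S \<Longrightarrow> f holomorphic_on S \<Longrightarrow>
        (\<And>z. z \<in> cball cxw \<rho>2 \<Longrightarrow> norm (f z) \<le> A) \<Longrightarrow> norm (ell m f) \<le> A * D / \<rho>2 ^ m"
    using ell_bound[OF R2] by metis
  obtain A where A: "\<And>z. z \<in> cball cxw \<rho>2 \<Longrightarrow> norm (T z) \<le> A"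
    using cball_bounded[OF cball_eball[OF \<rho>(3)] T_holomorphic] by blast
  have "norm (ell m T * poly (Bp m) x) \<le> A * D * C * (\<rho>1 / \<rho>2) ^ m" if "x \<in> K" for m x
  proof -
    have l: "norm (ell m T) \<le> A * D / \<rho>2 ^ m"
      by (rule D[OF open_eball cball_eball[OF \<rho>(3)] T_holomorphic A])
    hence "norm (ell m T) * norm (poly (Bp m) x) \<le> (A * D / \<rho>2 ^ m) * (C * \<rho>1 ^ m)"
      using that \<rho>(4) C(2) order_trans[OF norm_ge_zero l] by (intro mult_mono) auto
    thus ?thesis by (simp add: norm_mult power_divide)
  qed
  thus ?thesis using pos \<rho>(2) by (intro exI[of _ "A * D * C"] exI[of _ "\<rho>1 / \<rho>2"]) auto
qed

text \<open>\<open>T\<close> is compared with its Taylor polynomial \<open>f N\<close>, whose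
  expansion is exact with \<open>N\<close> terms. Where the difference is below
  \<open>\<epsilon>\<close> on the disk of radius \<open>\<rho>2\<close>, its functionals are at
  most \<open>\<epsilon> * D / \<rho>2 ^ m\<close>, so its expansion is bounded by
  \<open>\<epsilon>\<close> times a geometric series, uniformly in \<open>N\<close>.\<close>

lemma expansion:
  assumes x: "x \<in> eball cxw r"
  shows "(\<lambda>m. ell m T * poly (Bp m) x) sums T x"
proof -
  obtain \<rho>1 \<rho>2 where \<rho>: "R < \<rho>1" "\<rho>1 < \<rho>2" "ereal \<rho>2 < r" "{x} \<subseteq> cball cxw \<rho>1"
  proof (rule radii[of "{x}"])
    show "{x} \<subseteq> eball cxw r" using x by simp
  qed auto
  have R2: "R < \<rho>2" and pos: "0 < \<rho>1" "0 < \<rho>2" using \<rho> R_bounds by linarith+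
  define q where "q = \<rho>1 / \<rho>2"
  have q: "0 < q" "q < 1" using pos \<rho> by (auto simp: q_def)
  obtain C where C: "C > 0" "\<And>m x. x \<in> cball cxw \<rho>1 \<Longrightarrow> norm (poly (Bp m) x) \<le> C * \<rho>1 ^ m"
    using Bp_bound[OF \<rho>(1)] by blast
  obtain D where D: "D > 0" "\<And>m S f A. open S \<Longrightarrow> cball cxw \<rho>2 \<subseteq> S \<Longrightarrow> f holomorphic_on S \<Longrightarrow>
        (\<And>z. z \<in> cball cxw \<rho>2 \<Longrightarrow> norm (f z) \<le> A) \<Longrightarrow> norm (ell m f) \<le> A * D / \<rho>2 ^ m"
    using ell_bound[OF R2] by metis
  define f where "f N z = (\<Sum>n<N. fps_nth F n * (z - cxw) ^ n)" for N z
  have f_hol: "f N holomorphic_on S" for N S unfolding f_def by (intro holomorphic_intros)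
  have "uniform_limit (cball cxw \<rho>2) f T sequentially"
    using powser_uniform_limit[of \<rho>2 "fps_nth F" cxw] \<rho>(3)
    by (simp add: f_def[abs_def] T eval_fps_def r fps_conv_radius_def)
  hence unif: "\<forall>\<^sub>F N in sequentially. \<forall>z\<in>cball cxw \<rho>2. dist (f N z) (T z) < \<epsilon>" if "\<epsilon> > 0" for \<epsilon>
    using that unfolding uniform_limit_iff by blast
  \<comment> \<open>The series bounds the expansion of \<open>T - f N\<close>, and the summand 1
    accounts for \<open>f N x - T x\<close>.\<close>
  define B where "B = D * C / (1 - q) + 1"
  have B: "B > 0" using D C q by (simp add: B_def add_pos_pos)
  have close: "norm ((\<Sum>m<N. ell m T * poly (Bp m) x) - T x) \<le> \<epsilon> * B"
    if \<epsilon>: "\<epsilon> > 0" and N: "\<And>z. z \<in> cball cxw \<rho>2 \<Longrightarrow> dist (f N z) (T z) < \<epsilon>" for N \<epsilon>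
  proof -
    have d_hol: "(\<lambda>z. T z - f N z) holomorphic_on eball cxw r"
      by (intro holomorphic_on_diff T_holomorphic f_hol)
    have ell_split: "ell m T = ell m (\<lambda>z. T z - f N z) + ell m (f N)" for m
      using ell_add[OF R2 open_eball cball_eball[OF \<rho>(3)] d_hol f_hol[of N], of m] by simp
    have f_exp: "f N x = (\<Sum>m<N. ell m (f N) * poly (Bp m) x)"
      unfolding f_def by (rule polynomial_expansion)
    have "(\<Sum>m<N. ell m T * poly (Bp m) x) - T x
        = (\<Sum>m<N. ell m (\<lambda>z. T z - f N z) * poly (Bp m) x) + (f N x - T x)"
      unfolding ell_split f_exp by (simp add: distrib_right sum.distrib)
    also have "norm \<dots> \<le> norm (\<Sum>m<N. ell m (\<lambda>z. T z - f N z) * poly (Bp m) x) + norm (f N x - T x)"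
      by (rule norm_triangle_ineq)
    also have "norm (\<Sum>m<N. ell m (\<lambda>z. T z - f N z) * poly (Bp m) x) \<le> (\<Sum>m<N. \<epsilon> * D * C * q ^ m)"
    proof (rule sum_norm_le)
      fix m
      have "norm (ell m (\<lambda>z. T z - f N z)) \<le> \<epsilon> * D / \<rho>2 ^ m"
        by (rule D(2)[OF open_eball cball_eball[OF \<rho>(3)] d_hol])
           (use N in \<open>auto simp: dist_norm norm_minus_commute less_imp_le\<close>)
      hence "norm (ell m (\<lambda>z. T z - f N z)) * norm (poly (Bp m) x) \<le> (\<epsilon> * D / \<rho>2 ^ m) * (C * \<rho>1 ^ m)"
        using \<rho>(4) \<epsilon> D(1) pos by (intro mult_mono C) auto
      thus "norm (ell m (\<lambda>z. T z - f N z) * poly (Bp m) x) \<le> \<epsilon> * D * C * q ^ m"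
        by (simp add: norm_mult q_def power_divide)
    qed
    also have "(\<Sum>m<N. \<epsilon> * D * C * q ^ m) \<le> \<epsilon> * D * C * (1 / (1 - q))"
      unfolding sum_distrib_left[symmetric]
    proof (rule mult_left_mono)
      show "(\<Sum>m<N. q ^ m) \<le> 1 / (1 - q)"
        using q by (subst sum_gp_strict) (auto intro!: divide_right_mono)
    qed (use \<epsilon> C D in auto)
    also have "norm (f N x - T x) \<le> \<epsilon>"
      using N[of x] \<rho>(2,4) by (auto simp: dist_norm)
    finally show ?thesis by (simp add: B_def algebra_simps)
  qed
  show ?thesis unfolding sums_def
  proof (rule LIMSEQ_I)
    fix e :: real assume e: "e > 0"
    have "\<forall>\<^sub>F N in sequentially. norm ((\<Sum>m<N. ell m T * poly (Bp m) x) - T x) < e"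
      using unif[of "e / (2 * B)"]
    proof (rule eventually_mono)
      fix N assume N: "\<forall>z\<in>cball cxw \<rho>2. dist (f N z) (T z) < e / (2 * B)"
      have "norm ((\<Sum>m<N. ell m T * poly (Bp m) x) - T x) \<le> e / (2 * B) * B"
        using N e B by (intro close) auto
      also have "\<dots> < e" using e B by simp
      finally show "norm ((\<Sum>m<N. ell m T * poly (Bp m) x) - T x) < e" .
    qed (use e B in simp)
    thus "\<exists>N0. \<forall>N\<ge>N0. norm ((\<Sum>m<N. ell m T * poly (Bp m) x) - T x) < e"
      by (simp add: eventually_sequentially)
  qed
qed

end

lemma exp_term_eq: "exp_term b w f m x = ell m (taylor_sum f cxw) * poly (Bp m) x"
  by (simp add: exp_term_def ell_def cxw_def B_poly_eq)

end

theorem theorem4: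
  fixes b :: nat and w :: "nat list" and f :: "complex \<Rightarrow> complex"
    and x\<^sub>w :: real and r :: ereal
  assumes "b > 1" and "w \<noteq> []" and "w \<in> lists {..<b}"
    and "x\<^sub>w = center b w"
    and "f analytic_on {complex_of_real x\<^sub>w}"
    and "r = fps_conv_radius (fps_expansion f (complex_of_real x\<^sub>w))"
    and "ereal (max x\<^sub>w (1 - x\<^sub>w)) < r"
  shows "(\<forall>x\<in>eball (complex_of_real x\<^sub>w) r.
            (\<lambda>m. exp_term b w f m x) sums taylor_sum f (complex_of_real x\<^sub>w) x) \<and>
         (\<forall>K. compact K \<and> K \<subseteq> eball (complex_of_real x\<^sub>w) r \<longrightarrow>
            (\<exists>C \<rho>. 0 \<le> \<rho> \<and> \<rho> < 1 \<and>
               (\<forall>m. \<forall>x\<in>K. norm (exp_term b w f m x) \<le> C * \<rho> ^ m)))"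
proof -
  interpret gap_setting b w using assms(1-3) by unfold_locales
  have cxw: "complex_of_real x\<^sub>w = cxw" by (simp add: cxw_def assms(4))
  have T: "taylor_sum f cxw = (\<lambda>z. eval_fps (fps_expansion f cxw) (z - cxw))"
    by (simp add: taylor_sum_def fun_eq_iff)
  have R: "ereal R < r" using assms(4,7) by (simp add: R_def)
  have r: "r = fps_conv_radius (fps_expansion f cxw)" using assms(6) by (simp add: cxw)
  show ?thesis
    unfolding cxw exp_term_eq using expansion[OF r R T] geometric_bound[OF r R T] by blast
qed

end
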